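(* Let $\alpha\in[g,G]$. Then $(\Omega_\alpha,\mathcal B_{\Omega_\alpha},\tilde\mu_\alpha,\Phi_\alpha)$ gives the natural extension (in the sense of Rohlin) of $(I_\alpha,\mathcal B_{I_\alpha},\nu_\alpha,\varphi_\alpha)$.
   Context: $g=\frac12(\sqrt5-1)$, $G=\frac12(\sqrt5+1)$, $[\cdot]$ in the formula for $d_\alpha$ is the integer part (floor); $\mathcal B_C$ is the Borel $\sigma$-algebra on $C$. $I_\alpha=[\alpha-2,\alpha)$. For $x\ne0$, $d_\alpha(x)=2\left[\frac1{2|x|}+\frac{1-\alpha}2\right]+1$ and $\varphi_\alpha(x)=\frac1{|x|}-d_\alpha(x)$, with $\varphi_\alpha(0)=0$; the same formulas at $x=\alpha$ define $\varphi_\alpha(\alpha)=\frac1\alpha-d_\alpha(\alpha)$. With $e(x)=\operatorname{sign}(x)$, define for $x\neq0$ $$\Phi_\alpha(x,y)=\left(\varphi_\alpha(x),\frac1{d_\alpha(x)+e(x)y}\right).$$ For $g<\alpha<G$, $$\Omega_\alpha=\big(I_\alpha\times[0,2-G)\big)\cup\big((\varphi_\alpha(\alpha),\alpha)\times(2-G,1]\big)\cup\big([\varphi_\alpha(\alpha-2),\alpha)\times[1,G)\big),$$ while $\Omega_g=\big([g-2,g)\times[0,1-g)\big)\cup\big([\frac{g-1}{2-g},g)\times[1,G)\big)$ and $\Omega_G=[G-2,G)\times[0,1)$. Let $d\mu_\alpha=(1+xy)^{-2}dx\,dy$ on $\Omega_\alpha$ (total mass $3\log G$), $\tilde\mu_\alpha=(3\log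 G)^{-1}\mu_\alpha$, and $\nu_\alpha(E)=\tilde\mu_\alpha(\{(x,y)\in\Omega_\alpha:x\in E\})$ for $E\in\mathcal B_{I_\alpha}$. Let $\pi_\alpha:\Omega_\alpha\to I_\alpha$, $\pi_\alpha(x,y)=x$. Being the natural extension means: $\Phi_\alpha$ is, up to null-sets, an invertible bi-measurable $\tilde\mu_\alpha$-preserving transformation of $\Omega_\alpha$; $\pi_\alpha\Phi_\alpha=\varphi_\alpha\pi_\alpha$ almost everywhere and $\nu_\alpha(E)=\tilde\mu_\alpha(\pi_\alpha^{-1}(E))$ for all $E\in\mathcal B_{I_\alpha}$ (it is an extension); and the extension is minimal, i.e. $\bigvee_{n=0}^\infty\Phi_\alpha^n\pi_\alpha^{-1}(\mathcal B_{I_\alpha})=\mathcal B_{\Omega_\alpha}$ modulo null-sets. *)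

theory Defs
  imports "HOL-Analysis.Analysis"
begin

definition gold_g :: real where
  "gold_g = (sqrt 5 - 1) / 2"

definition gold_G :: real where
  "gold_G = (sqrt 5 + 1) / 2"

definition I_alpha :: "real \<Rightarrow> real set" where
  "I_alpha \<alpha> = {\<alpha> - 2..<\<alpha>}"

definition d_alpha :: "real \<Rightarrow> real \<Rightarrow> int" where
  "d_alpha \<alpha> x = 2 * \<lfloor>1 / (2 * \<bar>x\<bar>) + (1 - \<alpha>) / 2\<rfloor> + 1"

definition phi_alpha :: "real \<Rightarrow> real \<Rightarrow> real" where
  "phi_alpha \<alpha> x = (if x = 0 then 0 else 1 / \<bar>x\<bar> - of_int (d_alpha \<alpha> x))"

(* The value on the null set x = 0, where the formula is not defined, is arbitrary. *)
definition Phi_alpha :: "real \<Rightarrow> real \<times> real \<Rightarrow> real \<times> real" where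
  "Phi_alpha \<alpha> = (\<lambda>(x, y).
     if x = 0 then (0, 0)
     else (phi_alpha \<alpha> x, 1 / (of_int (d_alpha \<alpha> x) + sgn x * y)))"

definition Omega_alpha :: "real \<Rightarrow> (real \<times> real) set" where
  "Omega_alpha \<alpha> =
     (if \<alpha> = gold_g then
        {gold_g - 2..<gold_g} \<times> {0..<1 - gold_g} \<union>
        {(gold_g - 1) / (2 - gold_g)..<gold_g} \<times> {1..<gold_G}
      else if \<alpha> = gold_G then
        {gold_G - 2..<gold_G} \<times> {0..<1}
      else
        I_alpha \<alpha> \<times> {0..<2 - gold_G} \<union>
        {phi_alpha \<alpha> \<alpha><..<\<alpha>} \<times> {2 - gold_G<..1} \<union>
        {phi_alpha \<alpha> (\<alpha> - 2)..<\<alpha>} \<times> {1..<gold_G})"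

definition mu_alpha :: "real \<Rightarrow> (real \<times> real) measure" where
  "mu_alpha \<alpha> =
     density (restrict_space lborel (Omega_alpha \<alpha>))
       (\<lambda>(x, y). ennreal (1 / (1 + x * y)\<^sup>2))"

definition mu_tilde_alpha :: "real \<Rightarrow> (real \<times> real) measure" where
  "mu_tilde_alpha \<alpha> = scale_measure (ennreal (1 / (3 * ln gold_G))) (mu_alpha \<alpha>)"

definition nu_alpha :: "real \<Rightarrow> real measure" where
  "nu_alpha \<alpha> = distr (mu_tilde_alpha \<alpha>) (restrict_space borel (I_alpha \<alpha>)) fst"

(* A is a set of full measure on which T is an honest invertible bi-measurable
   measure-preserving transformation.  A pair of full-measure sets A, B with T bijective
   from A to B would give the same notion: pass to the points whose whole two-sided orbit
   stays in the intersection of A and B. *)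
definition automorphism_on :: "'a measure \<Rightarrow> ('a \<Rightarrow> 'a) \<Rightarrow> 'a set \<Rightarrow> bool" where
  "automorphism_on M T A \<longleftrightarrow>
     A \<in> sets M \<and> space M - A \<in> null_sets M \<and>
     bij_betw T A A \<and>
     T \<in> measurable (restrict_space M A) (restrict_space M A) \<and>
     the_inv_into A T \<in> measurable (restrict_space M A) (restrict_space M A) \<and>
     distr (restrict_space M A) (restrict_space M A) T = restrict_space M A"

definition is_extension ::
  "'a measure \<Rightarrow> ('a \<Rightarrow> 'a) \<Rightarrow> 'b measure \<Rightarrow> ('b \<Rightarrow> 'b) \<Rightarrow> ('a \<Rightarrow> 'b) \<Rightarrow> bool" where
  "is_extension M T N S p \<longleftrightarrow>
     p \<in> measurable M N \<and>
     (AE z in M. p (T z) = S (p z)) \<and>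
     (\<forall>E\<in>sets N. emeasure N E = emeasure M (p -` E \<inter> space M))"

definition eq_mod_null :: "'a measure \<Rightarrow> 'a set set \<Rightarrow> 'a set set \<Rightarrow> bool" where
  "eq_mod_null M \<A> \<B> \<longleftrightarrow>
     (\<forall>A\<in>\<A>. \<exists>B\<in>\<B>. (A - B) \<union> (B - A) \<in> null_sets M) \<and>
     (\<forall>B\<in>\<B>. \<exists>A\<in>\<A>. (A - B) \<union> (B - A) \<in> null_sets M)"

(* The join over n of the forward images T^n (p^-1 (sets N)) is formed inside the
   full-measure set A, where T is a bijection; modulo null sets it does not depend on A. *)
definition is_natural_extension ::
  "'a measure \<Rightarrow> ('a \<Rightarrow> 'a) \<Rightarrow> 'b measure \<Rightarrow> ('b \<Rightarrow> 'b) \<Rightarrow> ('a \<Rightarrow> 'b) \<Rightarrow> bool" where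
  "is_natural_extension M T N S p \<longleftrightarrow>
     is_extension M T N S p \<and>
     (\<exists>A. automorphism_on M T A \<and>
          eq_mod_null M
            (sigma_sets A {(T ^^ n) ` (p -` E \<inter> A) |n E. E \<in> sets N})
            (sets M))"

end

theory Submission
  imports Defs
begin

text \<open>
  Up to countably many lines, \<open>\<Omega>\<^sub>\<alpha>\<close> is described uniformly for all \<open>\<alpha> \<in> [g, G]\<close>: the fibre over \<open>x\<close>
  contains \<open>(0, 2 - G)\<close>, it contains \<open>(2 - G, 1)\<close> iff \<open>x > 1 / \<alpha> - 1\<close>, and it contains \<open>(1, G)\<close> iff
  \<open>x > (\<alpha> - 1) / (2 - \<alpha>)\<close>. Given an image point \<open>(x, y)\<close>, the number \<open>w = 1 / y\<close> lies between two
  consecutive odd numbers \<open>k < w < k + 2\<close>, and the only possible preimages have digit \<open>k\<close> with sign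
  \<open>+\<close> or digit \<open>k + 2\<close> with sign \<open>-\<close>. Comparing the fibre conditions of the two candidates shows
  that exactly one of them lies in the domain. Removing all points with a coordinate in the
  countable field generated by \<open>\<alpha>\<close> and \<open>\<surd>5\<close> makes this an exact bijection, because that field is
  preserved by every branch and its inverse.

  On each branch, \<open>1 + xy\<close> transforms by the square root of the Jacobian, so the density is invariant.
  For minimality, points with the same last \<open>n\<close> digits have second coordinates differing by
  \<open>O((81/100)\<^sup>n)\<close>, so \<open>y\<close> is measurable with respect to the past digits, that is, with respect to the
  join of the forward images of the base \<open>\<sigma>\<close>-algebra.
\<close>

section \<open>Arithmetic of the branches\<close>

datatype field_expr = Param | Sqrt5 | One | Diff field_expr field_expr | Mult field_expr field_expr
  | Inv field_expr

instance field_expr :: countable by countable_datatype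

primrec field_val :: "real \<Rightarrow> field_expr \<Rightarrow> real" where
  "field_val \<alpha> Param = \<alpha>"
| "field_val \<alpha> Sqrt5 = sqrt 5"
| "field_val \<alpha> One = 1"
| "field_val \<alpha> (Diff a b) = field_val \<alpha> a - field_val \<alpha> b"
| "field_val \<alpha> (Mult a b) = field_val \<alpha> a * field_val \<alpha> b"
| "field_val \<alpha> (Inv a) = inverse (field_val \<alpha> a)"

text \<open>Taking values of finite terms makes countability immediate from countability of the term
  type, and each constructor yields one closure rule. \<open>Inv\<close> is total because the
  inverse of 0 is 0.\<close>

definition param_field :: "real \<Rightarrow> real set" where
  "param_field \<alpha> = range (field_val \<alpha>)"

lemma countable_param_field: "countable (param_field \<alpha>)"
  unfolding param_field_def by simp

lemma param_field_base: "\<alpha> \<in> param_field \<alpha>" "sqrt 5 \<in> param_field \<alpha>" "1 \<in> param_field \<alpha>"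
  unfolding param_field_def
  by (metis field_val.simps(1) rangeI, metis field_val.simps(2) rangeI, metis field_val.simps(3) rangeI)

lemma param_field_diff: "a \<in> param_field \<alpha> \<Longrightarrow> b \<in> param_field \<alpha> \<Longrightarrow> a - b \<in> param_field \<alpha>"
  unfolding param_field_def by (auto simp flip: field_val.simps(4))

lemma param_field_mult: "a \<in> param_field \<alpha> \<Longrightarrow> b \<in> param_field \<alpha> \<Longrightarrow> a * b \<in> param_field \<alpha>"
  unfolding param_field_def by (auto simp flip: field_val.simps(5))

lemma param_field_inverse: "a \<in> param_field \<alpha> \<Longrightarrow> inverse a \<in> param_field \<alpha>"
  unfolding param_field_def by (auto simp flip: field_val.simps(6))

lemma param_field_zero: "0 \<in> param_field \<alpha>"
  using param_field_diff[OF param_field_base(3) param_field_base(3)] by simp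

lemma param_field_uminus: "a \<in> param_field \<alpha> \<Longrightarrow> - a \<in> param_field \<alpha>"
  using param_field_diff[OF param_field_zero] by fastforce

lemma param_field_add: "a \<in> param_field \<alpha> \<Longrightarrow> b \<in> param_field \<alpha> \<Longrightarrow> a + b \<in> param_field \<alpha>"
  using param_field_diff[of a \<alpha> "- b"] param_field_uminus by fastforce

lemma param_field_divide: "a \<in> param_field \<alpha> \<Longrightarrow> b \<in> param_field \<alpha> \<Longrightarrow> a / b \<in> param_field \<alpha>"
  by (simp add: divide_inverse param_field_mult param_field_inverse)

lemma param_field_of_nat: "of_nat n \<in> param_field \<alpha>"
  by (induction n) (auto intro: param_field_zero param_field_add param_field_base)

lemma param_field_of_int: "of_int n \<in> param_field \<alpha>"
  by (cases n rule: int_cases2) (auto intro: param_field_of_nat param_field_uminus)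

lemma param_field_numeral: "numeral n \<in> param_field \<alpha>"
  using param_field_of_nat[of "numeral n" \<alpha>] by simp

lemma param_field_gold_G: "gold_G \<in> param_field \<alpha>"
  unfolding gold_G_def
  by (intro param_field_divide param_field_add param_field_base param_field_numeral)

lemmas param_field_intros =
  param_field_base param_field_diff param_field_mult param_field_zero param_field_uminus
  param_field_add param_field_divide param_field_of_int param_field_numeral param_field_gold_G

text \<open>The sign of \<open>x\<close> and its digit are packed into one odd integer.\<close>

definition signed_digit :: "real \<Rightarrow> real \<Rightarrow> int" where
  "signed_digit \<alpha> x = (if x < 0 then - d_alpha \<alpha> x else d_alpha \<alpha> x)"

text \<open>This solves the branch equations for sign \<open>sgn m\<close> and digit
  \<open>\<bar>m\<bar>\<close> formally. It is defined on the whole plane; whether its value lies in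
  the domain is decided separately.\<close>

definition inv_branch :: "int \<Rightarrow> real \<times> real \<Rightarrow> real \<times> real" where
  "inv_branch m = (\<lambda>(x, y). (of_int (sgn m) / (x + of_int \<bar>m\<bar>), of_int (sgn m) * (1 / y - of_int \<bar>m\<bar>)))"

text \<open>The interval from \<alpha> - 2 to \<alpha> is half-open of length 2, so exactly one odd
  shift of 1 / |x| falls into it. Digits are identified below only through this
  characterisation.\<close>

lemma d_alpha_eqI:
  assumes "odd k" "\<alpha> - 2 \<le> 1 / \<bar>x\<bar> - of_int k" "1 / \<bar>x\<bar> - of_int k < \<alpha>"
  shows "d_alpha \<alpha> x = k"
proof -
  define t where "t = 1 / \<bar>x\<bar>"
  obtain j where j: "k = 2 * j + 1" using assms(1) by (elim oddE)
  have t: "\<alpha> - 2 \<le> t - (2 * of_int j + 1)" "t - (2 * of_int j + 1) < \<alpha>"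
    using assms(2,3) by (simp_all add: j t_def)
  have "\<lfloor>t / 2 + (1 - \<alpha>) / 2\<rfloor> = j"
    using t by (intro floor_unique) (simp_all add: field_simps)
  moreover have "1 / (2 * \<bar>x\<bar>) = t / 2" by (simp add: t_def)
  ultimately show ?thesis by (simp only: d_alpha_def j)
qed

lemma d_alpha_bounds:
  fixes \<alpha> x :: real
  shows "\<alpha> - 2 \<le> 1 / \<bar>x\<bar> - of_int (d_alpha \<alpha> x)" "1 / \<bar>x\<bar> - of_int (d_alpha \<alpha> x) < \<alpha>"
proof -
  define t where "t = 1 / \<bar>x\<bar>"
  define j where "j = \<lfloor>t / 2 + (1 - \<alpha>) / 2\<rfloor>"
  have j: "of_int j \<le> t / 2 + (1 - \<alpha>) / 2" "t / 2 + (1 - \<alpha>) / 2 < of_int j + 1"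
    unfolding j_def by linarith+
  have "1 / (2 * \<bar>x\<bar>) = t / 2" by (simp add: t_def)
  then have d: "real_of_int (d_alpha \<alpha> x) = 2 * of_int j + 1"
    by (simp only: d_alpha_def j_def of_int_add of_int_mult of_int_numeral of_int_1)
  show "\<alpha> - 2 \<le> 1 / \<bar>x\<bar> - of_int (d_alpha \<alpha> x)" "1 / \<bar>x\<bar> - of_int (d_alpha \<alpha> x) < \<alpha>"
    unfolding d t_def[symmetric] using j by (simp_all add: field_simps)
qed

lemma odd_d_alpha: "odd (d_alpha \<alpha> x)"
  by (simp add: d_alpha_def)

section \<open>Numerical and algebraic facts about the golden ratio\<close>

lemma gold_G_bounds: "809/500 < gold_G" "gold_G < 1619/1000"
proof -
  have "2236/1000 < sqrt 5" by (rule real_less_rsqrt) (simp add: power2_eq_square)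
  moreover have "sqrt 5 < 2238/1000" by (rule real_less_lsqrt) (simp_all add: power2_eq_square)
  ultimately show "809/500 < gold_G" "gold_G < 1619/1000" unfolding gold_G_def by auto
qed

lemma gold_G_square: "gold_G * gold_G = gold_G + 1"
  unfolding gold_G_def by (simp add: field_simps)

lemma gold_g_eq: "gold_g = gold_G - 1"
  unfolding gold_g_def gold_G_def by (simp add: field_simps)

lemma inverse_gold_G: "1 / gold_G = gold_G - 1"
  using gold_G_square gold_G_bounds by (simp add: field_simps)

text \<open>This turns the lower threshold 2 - G for a height into the upper threshold 1 + G for its
  reciprocal, which is a digit plus or minus the previous height.\<close>

lemma inverse_gold_G_add1: "1 / (1 + gold_G) = 2 - gold_G"
  using gold_G_square gold_G_bounds by (simp add: field_simps)

lemma less_mult_imp_pos: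
  fixes a u c :: real
  shows "c < a * u \<Longrightarrow> 0 \<le> c \<Longrightarrow> 0 < u \<Longrightarrow> 0 < a"
  by (meson le_less_trans zero_less_mult_pos2)

section \<open>The domain \<open>core\<close> and its forward invariance\<close>

locale odd_alpha =
  fixes \<alpha> :: real
  assumes alpha_ge: "gold_g \<le> \<alpha>" and alpha_le: "\<alpha> \<le> gold_G"
begin

abbreviation "K \<equiv> param_field \<alpha>"
abbreviation "G \<equiv> gold_G"
abbreviation "\<phi> \<equiv> phi_alpha \<alpha>"
abbreviation "\<Phi> \<equiv> Phi_alpha \<alpha>"
abbreviation "dg \<equiv> d_alpha \<alpha>"

text \<open>The fibre conditions are multiplied out, so no case distinction in \<alpha> is needed:
  at \<alpha> = g the middle condition contradicts x < \<alpha>, and at \<alpha> = G the top one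
  does. Removing \<open>K\<close> also removes x = 0 and all boundary lines.\<close>

definition core :: "(real \<times> real) set" where
  "core = {(x, y). x \<notin> K \<and> y \<notin> K \<and> \<alpha> - 2 < x \<and> x < \<alpha> \<and> 0 < y \<and> y < G \<and>
     (2 - G < y \<and> y < 1 \<longrightarrow> 1 - \<alpha> < \<alpha> * x) \<and> (1 < y \<longrightarrow> \<alpha> - 1 < (2 - \<alpha>) * x)}"

lemma alpha_bounds: "618/1000 < \<alpha>" "\<alpha> < 1619/1000"
  using alpha_ge alpha_le gold_G_bounds gold_g_eq by auto

text \<open>g and G are the positive roots of t * t + t = 1 and t * t = t + 1. In this form the
  bounds on \<alpha> decide the strip comparisons below.\<close>

lemma alpha_quad: "1 \<le> \<alpha> * \<alpha> + \<alpha>" "\<alpha> * \<alpha> \<le> \<alpha> + 1"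
proof -
  have "gold_g * gold_g \<le> \<alpha> * \<alpha>"
    using alpha_ge gold_g_eq gold_G_bounds by (intro mult_mono) auto
  moreover have "gold_g * gold_g = 1 - gold_g"
    using gold_G_square unfolding gold_g_eq by (simp add: algebra_simps)
  ultimately show "1 \<le> \<alpha> * \<alpha> + \<alpha>" using alpha_ge by simp
  have "(G - \<alpha>) * (\<alpha> + (G - 1)) \<ge> 0"
    using alpha_le alpha_bounds gold_G_bounds by (intro mult_nonneg_nonneg) auto
  then show "\<alpha> * \<alpha> \<le> \<alpha> + 1"
    using gold_G_square by (simp add: algebra_simps)
qed

text \<open>It suffices that 1 / |x| exceeds \<alpha> - 1, since then the digit exceeds -1 and is
  odd. For \<alpha> > 1 this comes from |x| < \<alpha> and \<alpha> * (\<alpha> - 1) \<le>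
  1.\<close>

lemma dg_pos:
  assumes "\<alpha> - 2 < x" "x < \<alpha>" "x \<noteq> 0"
  shows "1 \<le> dg x"
proof -
  have pos: "0 < \<bar>x\<bar>" using assms by simp
  have "\<bar>x\<bar> * (\<alpha> - 1) < 1"
  proof (cases "\<alpha> \<le> 1")
    case True
    then have "\<bar>x\<bar> * (\<alpha> - 1) \<le> 0" by (simp add: mult_nonneg_nonpos)
    then show ?thesis by simp
  next
    case False
    then have "\<bar>x\<bar> < \<alpha>" using assms by auto
    then have "\<bar>x\<bar> * (\<alpha> - 1) < \<alpha> * (\<alpha> - 1)" using False by simp
    then show ?thesis using alpha_quad by (simp add: algebra_simps)
  qed
  then have "\<alpha> - 1 < 1 / \<bar>x\<bar>" using pos by (simp add: field_simps)
  then have "-1 < dg x" using d_alpha_bounds(2)[of x \<alpha>] by linarith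
  moreover have "odd (dg x)" by (rule odd_d_alpha)
  ultimately show ?thesis by presburger
qed

text \<open>A positive sign gives an image height below 1, so only the middle strip imposes a
  condition. It is reached only with digit 1, and there x < \<alpha> is exactly what is
  required.\<close>

lemma core_image_pos:
  assumes xy: "(x, y) \<in> core" and x: "0 < x"
  shows "(1 / x - of_int (dg x), 1 / (of_int (dg x) + y)) \<in> core"
proof -
  define k where "k = dg x"
  define x' where "x' = 1 / x - of_int k"
  define y' where "y' = 1 / (of_int k + y)"
  have d: "x \<notin> K" "y \<notin> K" "\<alpha> - 2 < x" "x < \<alpha>" "0 < y" "y < G"
     using xy by (auto simp: core_def)
  have k1: "1 \<le> k" and ko: "odd k" unfolding k_def using dg_pos d x odd_d_alpha by auto
  then have kr: "1 \<le> real_of_int k" by simp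
  have xu: "x = 1 / (x' + of_int k)" using x by (simp add: x'_def)
  have yw: "y = 1 / y' - of_int k" using d kr by (simp add: y'_def)
  have xK: "x' \<notin> K" using d(1) param_field_intros xu by metis
  have yK: "y' \<notin> K" using d(2) param_field_intros yw by metis
  have xl: "\<alpha> - 2 \<le> x'" "x' < \<alpha>"
    using d_alpha_bounds(1)[of \<alpha> x] d_alpha_bounds(2)[of x \<alpha>] x unfolding x'_def k_def by simp_all
  have "x' \<noteq> \<alpha> - 2" using xK param_field_intros by metis
  with xl have xl': "\<alpha> - 2 < x'" by simp
  have y1: "0 < y'" "y' < 1" using d kr by (auto simp: y'_def field_simps)
  have c: "1 - \<alpha> < \<alpha> * x'" if "2 - G < y'"
  proof -
    have "1 / (1 + G) < 1 / (of_int k + y)" using that unfolding inverse_gold_G_add1 y'_def .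
    then have "of_int k + y < 1 + G" using d kr gold_G_bounds by (simp add: field_simps)
    then have "k < 3" using d gold_G_bounds by linarith
    then have "k = 1" using k1 ko by presburger
    then show ?thesis using x d(4) alpha_bounds by (simp add: x'_def field_simps)
  qed
  have "(x', y') \<in> core" unfolding core_def using xK yK xl xl' y1 c gold_G_bounds by auto
  then show ?thesis by (simp add: x'_def y'_def k_def)
qed

text \<open>With x = -1 / u, the fibre conditions on x become linear inequalities in u = x' + k.
  Digits 1 and 3 are the only ones whose images can leave the bottom strip.\<close>

lemma core_image_neg:
  assumes xy: "(x, y) \<in> core" and x: "x < 0"
  shows "(- 1 / x - of_int (dg x), 1 / (of_int (dg x) - y)) \<in> core" "0 < of_int (dg x) - y"
proof -
  define k where "k = dg x"
  define x' where "x' = - 1 / x - of_int k"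
  define y' where "y' = 1 / (of_int k - y)"
  define u where "u = x' + of_int k"
  have d: "x \<notin> K" "y \<notin> K" "\<alpha> - 2 < x" "x < \<alpha>" "0 < y" "y < G"
    "2 - G < y \<and> y < 1 \<longrightarrow> 1 - \<alpha> < \<alpha> * x" "1 < y \<longrightarrow> \<alpha> - 1 < (2 - \<alpha>) * x"
     using xy by (auto simp: core_def)
  have k1: "1 \<le> k" and ko: "odd k" unfolding k_def using dg_pos d x odd_d_alpha by auto
  then have kr: "1 \<le> real_of_int k" by simp
  have u: "u > 0" "x = - (1 / u)" using x by (auto simp: u_def x'_def)
  have yne: "y \<noteq> 1" "y \<noteq> 2 - G" using d(2) param_field_intros by metis+
  have xl: "\<alpha> - 2 \<le> x'" "x' < \<alpha>"
    using d_alpha_bounds(1)[of \<alpha> x] d_alpha_bounds(2)[of x \<alpha>] x unfolding x'_def k_def by simp_all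
  have d7: "(\<alpha> - 1) * u > \<alpha>" if "2 - G < y" "y < 1"
    using d(7) that u by (simp add: field_simps)
  have d8: "(1 - \<alpha>) * u > 2 - \<alpha>" if "1 < y"
    using d(8) that u by (simp add: field_simps)
  \<comment> \<open>For digit 1 the bound x' < \<alpha> gives u < 1 + \<alpha>, which is
    incompatible with the fibre condition of the middle strip as well as of the top strip. This
    keeps the denominator above 1 / G.\<close>
  have yk1: "y < 2 - G" if "k = 1"
  proof (rule ccontr)
    assume "\<not> y < 2 - G"
    then consider "2 - G < y" "y < 1" | "1 < y" using yne by linarith
    then show False
    proof cases
      case 1
      then have *: "(\<alpha> - 1) * u > \<alpha>" by (rule d7)
      then have "\<alpha> > 1" using less_mult_imp_pos[OF * _ u(1)] alpha_bounds by simp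
      then have "(\<alpha> - 1) * u \<le> (\<alpha> - 1) * (1 + \<alpha>)"
        using xl that by (intro mult_left_mono) (auto simp: u_def)
      then show False using * alpha_quad by (simp add: algebra_simps)
    next
      case 2
      then have *: "(1 - \<alpha>) * u > 2 - \<alpha>" by (rule d8)
      then have a1: "\<alpha> < 1" using less_mult_imp_pos[OF * _ u(1)] alpha_bounds by simp
      then have "(1 - \<alpha>) * u \<le> (1 - \<alpha>) * (1 + \<alpha>)"
        using xl that by (intro mult_left_mono) (auto simp: u_def)
      then show False using * alpha_quad a1 by (simp add: algebra_simps)
    qed
  qed
  have kge: "k \<ge> 3" if "k \<noteq> 1" using k1 ko that by presburger
  have kyG: "of_int k - y > 1 / G"
    unfolding inverse_gold_G
  proof (cases "k = 1")
    case True
    then show "G - 1 < real_of_int k - y" using yk1 by simp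
  next
    case False
    then have "3 \<le> real_of_int k" using kge by linarith
    then show "G - 1 < real_of_int k - y" using d gold_G_bounds by simp
  qed
  then show "0 < of_int (dg x) - y" using gold_G_bounds by (simp add: k_def inverse_gold_G)
  then have ky: "0 < of_int k - y" by (simp add: k_def)
  have y1: "0 < y'" "y' < G" using ky kyG gold_G_bounds by (auto simp: y'_def field_simps)
  have xu: "x = - (1 / (x' + of_int k))" using u by (simp add: u_def)
  have yw: "y = of_int k - 1 / y'" using d ky by (simp add: y'_def)
  have xK: "x' \<notin> K" using d(1) param_field_intros xu by metis
  have yK: "y' \<notin> K" using d(2) param_field_intros yw by metis
  have "x' \<noteq> \<alpha> - 2" using xK param_field_intros by metis
  with xl have xl': "\<alpha> - 2 < x'" by simp
  \<comment> \<open>Digit 1 would give height above 1, and digits from 5 on give height below 2 - G.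
    So the digit is 3, the source lies above 2 - G, and its own fibre condition can be used.\<close>
  have c: "1 - \<alpha> < \<alpha> * x'" if y': "2 - G < y'" "y' < 1"
  proof -
    have "1 / (1 + G) < 1 / (of_int k - y)" using y' unfolding inverse_gold_G_add1 y'_def by simp
    then have kyl: "of_int k - y < 1 + G" using ky gold_G_bounds by (simp add: field_simps)
    then have "k < 5" using d gold_G_bounds by linarith
    moreover have "k \<noteq> 1" using y'(2) ky d by (auto simp: y'_def field_simps)
    ultimately have k3: "k = 3" using kge ko by presburger
    then have y2: "2 - G < y" using kyl by simp
    have u3: "u = x' + 3" by (simp add: u_def k3)
    show ?thesis
    proof (cases "y < 1")
      case True
      then have *: "(\<alpha> - 1) * u > \<alpha>" using d7 y2 by simp
      then have a1: "\<alpha> > 1" using less_mult_imp_pos[OF * _ u(1)] alpha_bounds by simp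
      have "(\<alpha> - 1) * (\<alpha> * x') > \<alpha> * (3 - 2 * \<alpha>)"
      proof -
        have "(\<alpha> - 1) * x' > 3 - 2 * \<alpha>" using * by (simp add: u3 algebra_simps)
        then have "\<alpha> * ((\<alpha> - 1) * x') > \<alpha> * (3 - 2 * \<alpha>)" using alpha_bounds by simp
        then show ?thesis by (simp add: algebra_simps)
      qed
      moreover have "\<alpha> * (3 - 2 * \<alpha>) \<ge> (\<alpha> - 1) * (1 - \<alpha>)"
        using alpha_quad by (simp add: algebra_simps)
      ultimately have "(\<alpha> - 1) * (1 - \<alpha>) < (\<alpha> - 1) * (\<alpha> * x')" by linarith
      then show ?thesis using a1 by simp
    next
      case False
      then have *: "(1 - \<alpha>) * u > 2 - \<alpha>" using d8 yne by simp
      then have a1: "\<alpha> < 1" using less_mult_imp_pos[OF * _ u(1)] alpha_bounds by simp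
      then have "(1 - \<alpha>) * u \<le> (1 - \<alpha>) * (3 + \<alpha>)"
        using xl by (intro mult_left_mono) (auto simp: u3)
      then have False using * alpha_quad a1 by (simp add: algebra_simps)
      then show ?thesis ..
    qed
  qed
  \<comment> \<open>A height above 1 forces digit 1, and then the condition is a rewriting of x >
    \<alpha> - 2.\<close>
  have b: "\<alpha> - 1 < (2 - \<alpha>) * x'" if y': "1 < y'"
  proof -
    have "of_int k - y < 1" using y' ky by (simp add: y'_def field_simps)
    then have "k < 3" using d gold_G_bounds by linarith
    then have k1: "k = 1" using kge by force
    have "1 / u < 2 - \<alpha>" using d(3) u by simp
    then have "1 < (2 - \<alpha>) * u" using u by (simp add: field_simps)
    then show ?thesis by (simp add: u_def k1 algebra_simps)
  qed
  have "(x', y') \<in> core" unfolding core_def using xK yK xl xl' y1 c b by auto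
  then show "(- 1 / x - of_int (dg x), 1 / (of_int (dg x) - y)) \<in> core"
    by (simp add: x'_def y'_def k_def)
qed

lemma core_nonzero: "(x, y) \<in> core \<Longrightarrow> x \<noteq> 0"
  using param_field_zero by (auto simp: core_def)

text \<open>The signed digit is the only information lost by forgetting the source: the inverse
  branch it selects returns the image to \<open>z\<close>. The positivity fact says that 1 / |x| is
  positive and matches the hypothesis of \<open>Phi_inv_branch\<close>.\<close>

lemma Phi_core:
  assumes "z \<in> core"
  shows "\<Phi> z \<in> core" "odd (signed_digit \<alpha> (fst z))" "inv_branch (signed_digit \<alpha> (fst z)) (\<Phi> z) = z"
    "0 < fst (\<Phi> z) + of_int \<bar>signed_digit \<alpha> (fst z)\<bar>"
proof -
  obtain x y where z: "z = (x, y)" by (cases z)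
  have xy: "(x, y) \<in> core" using assms z by simp
  have x0: "x \<noteq> 0" using core_nonzero xy by blast
  have k1: "1 \<le> dg x" using dg_pos xy x0 by (auto simp: core_def)
  have y0: "y > 0" using xy by (auto simp: core_def)
  show "odd (signed_digit \<alpha> (fst z))" using odd_d_alpha by (simp add: signed_digit_def)
  consider "0 < x" | "x < 0" using x0 by linarith
  then have "\<Phi> z \<in> core \<and> inv_branch (signed_digit \<alpha> (fst z)) (\<Phi> z) = z \<and>
    0 < fst (\<Phi> z) + of_int \<bar>signed_digit \<alpha> (fst z)\<bar>"
  proof cases
    case 1
    have "real_of_int (dg x) + y > 0" using y0 k1 by linarith
    then show ?thesis using core_image_pos[OF xy 1] 1 k1 y0
      by (simp add: z Phi_alpha_def phi_alpha_def signed_digit_def inv_branch_def)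
  next
    case 2
    show ?thesis using core_image_neg[OF xy 2] 2 k1 y0
      by (simp add: z Phi_alpha_def phi_alpha_def signed_digit_def inv_branch_def)
  qed
  then show "\<Phi> z \<in> core" "inv_branch (signed_digit \<alpha> (fst z)) (\<Phi> z) = z"
    "0 < fst (\<Phi> z) + of_int \<bar>signed_digit \<alpha> (fst z)\<bar>"
    by auto
qed

text \<open>The reciprocal of the absolute value of the new first coordinate is
  \<open>fst z + \<bar>m\<bar>\<close>, and subtracting the odd number \<open>\<bar>m\<bar>\<close>
  returns to the digit interval. So \<open>d_alpha_eqI\<close> identifies the digit.\<close>

lemma Phi_inv_branch:
  assumes "z \<in> core" "odd m" "0 < fst z + of_int \<bar>m\<bar>"
  shows "\<Phi> (inv_branch m z) = z" "signed_digit \<alpha> (fst (inv_branch m z)) = m"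
proof -
  obtain x y where z: "z = (x, y)" by (cases z)
  have xy: "\<alpha> - 2 < x" "x < \<alpha>" "0 < y" "0 < x + of_int \<bar>m\<bar>" using assms z by (auto simp: core_def)
  have m0: "m \<noteq> 0" using assms by auto
  define X :: real where "X = of_int (sgn m) / (x + of_int \<bar>m\<bar>)"
  have ax: "1 / \<bar>X\<bar> = x + of_int \<bar>m\<bar>" unfolding X_def using xy m0 by (auto simp: abs_divide sgn_if)
  have d: "dg X = \<bar>m\<bar>" using assms(2) xy ax by (intro d_alpha_eqI) auto
  have sx: "sgn X = of_int (sgn m)" "X \<noteq> 0" "X < 0 \<longleftrightarrow> m < 0" unfolding X_def using xy m0
    by (auto simp: sgn_if divide_simps split: if_splits)
  have ss: "real_of_int (sgn m) * (of_int (sgn m) * t) = t" for t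
    using m0 by (auto simp: sgn_if)
  have iz: "inv_branch m z = (X, of_int (sgn m) * (1 / y - of_int \<bar>m\<bar>))"
    by (simp add: z inv_branch_def X_def)
  have "phi_alpha \<alpha> X = x" unfolding phi_alpha_def using sx(2) ax d by simp
  then show "\<Phi> (inv_branch m z) = z"
    unfolding iz Phi_alpha_def using sx(2) by (simp only: prod.case d sx(1) ss z if_False) simp
  show "signed_digit \<alpha> (fst (inv_branch m z)) = m"
    unfolding iz using sx(3) by (simp add: signed_digit_def d)
qed

end

section \<open>Bijectivity\<close>

context odd_alpha
begin

text \<open>Both coordinates can be recovered from the new ones by field operations, so a new
  coordinate in \<open>K\<close> would force an old one into \<open>K\<close>.\<close>

lemma inv_branch_notin_field:
  assumes "x \<notin> K" "y \<notin> K" "s \<noteq> 0" "0 < y" "s \<in> K"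
  shows "s / (x + of_int k) \<notin> K" "s * (1 / y - of_int k) \<notin> K"
proof -
  have "x \<noteq> - of_int k"
    using assms(1) param_field_uminus[OF param_field_of_int[of k \<alpha>]] by auto
  then have "x + of_int k \<noteq> 0" by linarith
  then have e: "x = s / (s / (x + of_int k)) - of_int k" "1 / (s * (1 / y - of_int k) / s + of_int k) = y"
    using assms by auto
  show "s / (x + of_int k) \<notin> K"
    using assms(1,5) e(1) param_field_diff[OF param_field_divide param_field_of_int] by metis
  show "s * (1 / y - of_int k) \<notin> K"
  proof
    assume "s * (1 / y - of_int k) \<in> K"
    from param_field_divide[OF param_field_base(3) param_field_add[OF param_field_divide[OF this assms(5)]
      param_field_of_int]]
    have "1 / (s * (1 / y - of_int k) / s + of_int k) \<in> K"
      .
    then show False using assms(2) unfolding e(2) by contradiction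
  qed
qed

text \<open>The fibre conditions at the preimage are cleared of the positive denominator x + k. In
  this form they are linear in x + k and comparable with those of the negative candidate in the next
  lemma.\<close>

lemma inv_branch_pos_in_core:
  fixes k :: int
  assumes z: "(x, y) \<in> core" and k: "1 \<le> k" and u: "0 < x + of_int k" "1 < \<alpha> * (x + of_int k)"
    and y: "0 < 1 / y - of_int k" "1 / y - of_int k < G"
    and c: "2 - G < 1 / y - of_int k \<Longrightarrow> 1 / y - of_int k < 1 \<Longrightarrow> (1 - \<alpha>) * (x + of_int k) < \<alpha>"
    and b: "1 < 1 / y - of_int k \<Longrightarrow> (\<alpha> - 1) * (x + of_int k) < 2 - \<alpha>"
  shows "inv_branch k (x, y) \<in> core"
proof -
  have K: "1 / (x + of_int k) \<notin> K" "1 / y - of_int k \<notin> K"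
    using inv_branch_notin_field[of x y 1 k] z param_field_base by (auto simp: core_def)
  have "0 < 1 / (x + of_int k)" "1 / (x + of_int k) < \<alpha>"
    using u by (auto simp: field_simps)
  moreover have "\<alpha> - 2 < 1 / (x + of_int k)"
    using \<open>0 < 1 / (x + of_int k)\<close> alpha_bounds by linarith
  ultimately show ?thesis
    using K y c b u(1) k unfolding core_def inv_branch_def
    by (simp add: pos_less_divide_eq)
qed

lemma inv_branch_neg_in_core:
  fixes k :: int
  assumes z: "(x, y) \<in> core" and k: "1 \<le> k" and u: "0 < x + of_int k" "1 < (2 - \<alpha>) * (x + of_int k)"
    and y: "0 < of_int k - 1 / y" "of_int k - 1 / y < G"
    and c: "2 - G < of_int k - 1 / y \<Longrightarrow> of_int k - 1 / y < 1 \<Longrightarrow> \<alpha> < (\<alpha> - 1) * (x + of_int k)"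
    and b: "1 < of_int k - 1 / y \<Longrightarrow> 2 - \<alpha> < (1 - \<alpha>) * (x + of_int k)"
  shows "inv_branch (- k) (x, y) \<in> core"
proof -
  have "(-1::real) \<in> K" by (intro param_field_uminus param_field_base)
  then have K: "-1 / (x + of_int k) \<notin> K" "of_int k - 1 / y \<notin> K"
    using inv_branch_notin_field[of x y "-1" k] z by (auto simp: core_def)
  have "-1 / (x + of_int k) < 0" "\<alpha> - 2 < -1 / (x + of_int k)"
    using u by (auto simp: field_simps)
  moreover have "0 < \<alpha>" using alpha_bounds by simp
  ultimately have *: "-1 / (x + of_int k) < \<alpha>" "\<alpha> - 2 < -1 / (x + of_int k)" by linarith+
  have c': "1 - \<alpha> < \<alpha> * (-1 / (x + of_int k))" if "2 - G < of_int k - 1 / y" "of_int k - 1 / y < 1"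
    using c[OF that] u by (simp add: field_simps)
  have b': "\<alpha> - 1 < (2 - \<alpha>) * (-1 / (x + of_int k))" if "1 < of_int k - 1 / y"
    using b[OF that] u by (simp add: field_simps)
  have "(-1 / (x + of_int k), of_int k - 1 / y) \<in> core"
    using K y c' b' * unfolding core_def by blast
  moreover have "inv_branch (- k) (x, y) = (-1 / (x + of_int k), of_int k - 1 / y)"
    using k by (simp add: inv_branch_def)
  ultimately show ?thesis by simp
qed

text \<open>At most two signed digits fit the height, and in the zones where both fit, their fibre
  conditions are complementary strict inequalities. The equality case is excluded by the removal of
  \<open>K\<close>.\<close>

lemma exists_inv_branch:
  assumes "z \<in> core"
  shows "\<exists>m. odd m \<and> 0 < fst z + of_int \<bar>m\<bar> \<and> inv_branch m z \<in> core"
proof -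
  obtain x y where z: "z = (x, y)" by (cases z)
  have xy: "(x, y) \<in> core" using assms z by simp
  then have d: "x \<notin> K" "y \<notin> K" "\<alpha> - 2 < x" "x < \<alpha>" "0 < y" "y < G"
    "2 - G < y \<and> y < 1 \<longrightarrow> 1 - \<alpha> < \<alpha> * x" "1 < y \<longrightarrow> \<alpha> - 1 < (2 - \<alpha>) * x"
    by (auto simp: core_def)
  define w where "w = 1 / y"
  have yw: "y = 1 / w" using d by (simp add: w_def)
  have wK: "w \<notin> K" using d(2) yw by (auto intro: param_field_divide param_field_base)
  have wG: "w > G - 1" unfolding w_def inverse_gold_G[symmetric] using d gold_G_bounds
    by (simp add: frac_less2)
  show ?thesis
  proof (cases "w < 1")
    case True
    \<comment> \<open>Only digit 1 with negative sign produces such a height, and the top fibre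
      condition says precisely that its preimage -1 / (x + 1) lies to the right of \<alpha> -
      2.\<close>
    then have y1: "1 < y" using wG gold_G_bounds by (simp add: yw)
    then have b: "1 < (2 - \<alpha>) * (x + 1)" using d(8) by (simp add: algebra_simps)
    have a2: "0 < 2 - \<alpha>" using alpha_bounds by simp
    have u: "0 < x + 1" using zero_less_mult_pos[OF _ a2] b by (metis less_trans zero_less_one)
    have "inv_branch (-1) (x, y) \<in> core"
      by (rule inv_branch_neg_in_core[OF xy]) (use u b True wG gold_G_bounds d(5) in \<open>auto simp: w_def\<close>)
    then show ?thesis using u z by (intro exI[of _ "-1"]) auto
  next
    case False
    \<comment> \<open>The largest odd integer not exceeding w; the candidates are k with sign plus
      and k + 2 with sign minus.\<close>
    define k where "k = 2 * \<lfloor>(w - 1) / 2\<rfloor> + 1"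
    define j where "j = \<lfloor>(w - 1) / 2\<rfloor>"
    have "of_int j \<le> (w - 1) / 2" "(w - 1) / 2 < of_int j + 1"
      unfolding j_def by linarith+
    then have k: "of_int k \<le> w" "w < of_int k + 2"
      unfolding k_def j_def[symmetric] by (simp_all add: field_simps)
    have ko: "odd k" by (simp add: k_def)
    have k1: "1 \<le> k" using False by (simp add: k_def)
    then have kr: "1 \<le> real_of_int k" by simp
    have "of_int k \<in> K" "of_int k + 1 \<in> K" "of_int k + G \<in> K" "of_int k + (2 - G) \<in> K"
      by (intro param_field_intros)+
    then have notK: "w \<noteq> of_int k" "w \<noteq> of_int k + 1" "w \<noteq> of_int k + G" "w \<noteq> of_int k + (2 - G)"
      using wK by auto
    define u where "u = x + of_int k"
    have uK: "u \<notin> K"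
      using d(1) param_field_diff[of u \<alpha> "of_int k"] param_field_of_int by (auto simp: u_def)
    \<comment> \<open>This places 1 / u below \<alpha>. For k = 1 it is the middle fibre condition
      of the given point; for k \<ge> 3 the bound x > \<alpha> - 2 already gives u > 1 +
      \<alpha>.\<close>
    have P: "0 < u \<and> 1 < \<alpha> * u" if wl: "w < of_int k + G"
    proof (cases "k = 1")
      case True
      have "1 / w > 1 / (1 + G)" using wl True wG gold_G_bounds by (intro divide_strict_left_mono) auto
      then have "2 - G < y" by (simp add: yw inverse_gold_G_add1)
      moreover have "y < 1" using False notK(1) True by (simp add: yw)
      ultimately have "1 < \<alpha> * u" using d(7) by (simp add: u_def True algebra_simps)
      then show ?thesis using alpha_bounds zero_less_mult_pos[of \<alpha> u] by simp
    next
      case False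
      then have "3 \<le> k" using k1 ko by presburger
      then have "1 + \<alpha> < u" using d by (simp add: u_def)
      moreover have "\<alpha> * (1 + \<alpha>) < \<alpha> * u" using calculation alpha_bounds by simp
      ultimately show ?thesis using alpha_quad alpha_bounds by (simp add: algebra_simps)
    qed
    \<comment> \<open>The negative preimage lies to the right of \<alpha> - 2 in every zone, because
      u + 2 > 1 + \<alpha>.\<close>
    have N: "0 < u + 2" "1 < (2 - \<alpha>) * (u + 2)"
    proof -
      have u2: "1 + \<alpha> < u + 2" using d kr by (simp add: u_def)
      then show "0 < u + 2" using alpha_bounds by simp
      have "(2 - \<alpha>) * (1 + \<alpha>) < (2 - \<alpha>) * (u + 2)" using u2 alpha_bounds by simp
      then show "1 < (2 - \<alpha>) * (u + 2)" using alpha_quad by (simp add: algebra_simps)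
    qed
    have ko2: "odd (- (k + 2))" using ko by simp
    have pos: ?thesis if "w < of_int k + G" "2 - G < w - of_int k \<Longrightarrow> w - of_int k < 1 \<Longrightarrow> (1 - \<alpha>) * u < \<alpha>"
      "1 < w - of_int k \<Longrightarrow> (\<alpha> - 1) * u < 2 - \<alpha>"
    proof -
      have "inv_branch k (x, y) \<in> core"
        by (rule inv_branch_pos_in_core[OF xy k1]) (use that P k notK(1) in \<open>auto simp: w_def u_def\<close>)
      then show ?thesis using P[OF that(1)] ko k1 by (intro exI[of _ k]) (auto simp: z u_def)
    qed
    have neg: ?thesis if "of_int k + (2 - G) < w" "2 - G < of_int k + 2 - w \<Longrightarrow> of_int k + 2 - w < 1 \<Longrightarrow> \<alpha> < (\<alpha> - 1) * (u + 2)"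
      "1 < of_int k + 2 - w \<Longrightarrow> 2 - \<alpha> < (1 - \<alpha>) * (u + 2)"
    proof -
      have "inv_branch (- (k + 2)) (x, y) \<in> core"
        by (rule inv_branch_neg_in_core[OF xy]) (use that k1 k N in \<open>simp_all add: w_def u_def add.assoc\<close>)
      then show ?thesis using N ko2 k1 by (intro exI[of _ "- (k + 2)"]) (auto simp: z u_def)
    qed
    \<comment> \<open>The candidate heights are w - k and k + 2 - w, with sum 2. In the outer zones
      one of them is below 2 - G and hence unconditional; in the inner zones one is in the middle
      strip and the other in the top strip.\<close>
    consider "w < of_int k + (2 - G)" | "of_int k + (2 - G) < w" "w < of_int k + 1"
      | "of_int k + 1 < w" "w < of_int k + G" | "of_int k + G < w"
      using notK by linarith
    then show ?thesis
    proof cases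
      case 1
      then show ?thesis using gold_G_bounds by (intro pos) auto
    next
      case 2
      show ?thesis
      proof (cases "(1 - \<alpha>) * u < \<alpha>")
        case True
        then show ?thesis using 2 gold_G_bounds by (intro pos) auto
      next
        case False
        have "(1 - \<alpha>) * u \<noteq> \<alpha>"
        proof
          assume *: "(1 - \<alpha>) * u = \<alpha>"
          then have "1 - \<alpha> \<noteq> 0" by auto
          then have "u = \<alpha> / (1 - \<alpha>)" using * by (simp add: field_simps)
          then show False using uK by (simp add: param_field_intros)
        qed
        then have "2 - \<alpha> < (1 - \<alpha>) * (u + 2)" using False by (simp add: algebra_simps)
        then show ?thesis using 2 by (intro neg) auto
      qed
    next
      case 3
      show ?thesis
      proof (cases "(\<alpha> - 1) * u < 2 - \<alpha>")
        case True
        then show ?thesis using 3 by (intro pos) auto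
      next
        case False
        have "(\<alpha> - 1) * u \<noteq> 2 - \<alpha>"
        proof
          assume *: "(\<alpha> - 1) * u = 2 - \<alpha>"
          then have "\<alpha> - 1 \<noteq> 0" by auto
          then have "u = (2 - \<alpha>) / (\<alpha> - 1)" using * by (simp add: field_simps)
          then show False using uK by (simp add: param_field_intros)
        qed
        then have "\<alpha> < (\<alpha> - 1) * (u + 2)" using False by (simp add: algebra_simps)
        then show ?thesis using 3 gold_G_bounds by (intro neg) auto
      qed
    next
      case 4
      then show ?thesis using gold_G_bounds by (intro neg) auto
    qed
  qed
qed

text \<open>The two heights are positive and add up to l - k < 2 * G < 4, so l = k + 2. One height
  then lies in the middle strip and the other in the top strip, where the fibre conditions
  contradict each other.\<close>

lemma inv_branch_opposite_signs:
  fixes k l :: int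
  assumes "odd k" "odd l" "0 < x + of_int k"
    and "(1 / (x + of_int k), w - of_int k) \<in> core" "(- 1 / (x + of_int l), of_int l - w) \<in> core"
  shows False
proof -
  define u where "u = x + of_int k"
  define t where "t = w - of_int k"
  have d: "(1 / u, t) \<in> core" "(- 1 / (x + of_int l), of_int l - w) \<in> core"
    using assms by (auto simp: u_def t_def)
  have t: "0 < t" "t < G" "0 < of_int l - w" "of_int l - w < G" "t \<notin> K"
    using d by (auto simp: core_def)
  then have "0 < l - k" "l - k < 4" using gold_G_bounds unfolding t_def by linarith+
  then have l: "l = k + 2" using assms(1,2) by presburger
  have d2: "(- 1 / (u + 2), 2 - t) \<in> core" using d(2) by (simp add: l u_def t_def algebra_simps)
  have u: "0 < u" using assms(3) by (simp add: u_def)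
  have "t \<noteq> 1" using t(5) param_field_base(3)[of \<alpha>] by auto
  then consider "2 - G < t" "t < 1" "1 < 2 - t" | "1 < t" "2 - G < 2 - t" "2 - t < 1"
    using t d2 by (auto simp: core_def) linarith+
  then show False
  proof cases
    case 1
    then have "1 - \<alpha> < \<alpha> * (1 / u)" "\<alpha> - 1 < (2 - \<alpha>) * (- 1 / (u + 2))"
      using d(1) d2 by (auto simp: core_def)
    then have "(1 - \<alpha>) * u < \<alpha>" "2 - \<alpha> < (1 - \<alpha>) * (u + 2)" using u by (auto simp: field_simps)
    then show False by (simp add: algebra_simps)
  next
    case 2
    then have "\<alpha> - 1 < (2 - \<alpha>) * (1 / u)" "1 - \<alpha> < \<alpha> * (- 1 / (u + 2))"
      using d(1) d2 by (auto simp: core_def)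
    then have "(\<alpha> - 1) * u < 2 - \<alpha>" "\<alpha> < (\<alpha> - 1) * (u + 2)" using u by (auto simp: field_simps)
    then show False by (simp add: algebra_simps)
  qed
qed

lemma inv_branch_unique:
  assumes m: "odd m" "0 < fst z + of_int \<bar>m\<bar>" "inv_branch m z \<in> core"
    and n: "odd n" "0 < fst z + of_int \<bar>n\<bar>" "inv_branch n z \<in> core"
  shows "m = n"
proof -
  obtain x y where z: "z = (x, y)" by (cases z)
  define w where "w = 1 / y"
  have pos: "(1 / (x + of_int k), w - of_int k) \<in> core" if "0 < k" "inv_branch k z \<in> core" for k
    using that by (simp add: inv_branch_def z w_def)
  have neg: "(- 1 / (x + of_int (- k)), of_int (- k) - w) \<in> core" if "k < 0" "inv_branch k z \<in> core" for k
    using that by (simp add: inv_branch_def z w_def algebra_simps)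
  have bounds: "0 < t \<and> t < 2" if "(r, t) \<in> core" for r t
    using that gold_G_bounds by (auto simp: core_def)
  have nz: "m \<noteq> 0" "n \<noteq> 0" using m n by auto
  consider "0 < m" "0 < n" | "m < 0" "n < 0" | "0 < m" "n < 0" | "m < 0" "0 < n"
    using nz by linarith
  then show ?thesis
  proof cases
    case 1
    \<comment> \<open>With equal signs both heights lie between 0 and 2 and differ by m - n, which
      is even.\<close>
    have "\<bar>m - n\<bar> < 2" using bounds[OF pos[OF 1(1) m(3)]] bounds[OF pos[OF 1(2) n(3)]] by linarith
    then show ?thesis using m(1) n(1) by presburger
  next
    case 2
    have "\<bar>m - n\<bar> < 2" using bounds[OF neg[OF 2(1) m(3)]] bounds[OF neg[OF 2(2) n(3)]] by linarith
    then show ?thesis using m(1) n(1) by presburger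
  next
    case 3
    then show ?thesis
      using inv_branch_opposite_signs[of m "- n" x w] pos[OF 3(1) m(3)] neg[OF 3(2) n(3)] m n by (simp add: z)
  next
    case 4
    then show ?thesis
      using inv_branch_opposite_signs[of n "- m" x w] pos[OF 4(2) n(3)] neg[OF 4(1) m(3)] m n by (simp add: z)
  qed
qed

text \<open>Injectivity is the uniqueness of the admissible inverse branch, surjectivity its
  existence.\<close>

lemma bij_Phi: "bij_betw \<Phi> core core"
  unfolding bij_betw_def
proof
  show "inj_on \<Phi> core"
  proof (rule inj_onI)
    fix v w assume vw: "v \<in> core" "w \<in> core" "\<Phi> v = \<Phi> w"
    have "signed_digit \<alpha> (fst v) = signed_digit \<alpha> (fst w)"
    proof (rule inv_branch_unique)
      show "odd (signed_digit \<alpha> (fst v))" "odd (signed_digit \<alpha> (fst w))"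
        using Phi_core(2) vw by auto
      show "0 < fst (\<Phi> v) + of_int \<bar>signed_digit \<alpha> (fst v)\<bar>"
        "inv_branch (signed_digit \<alpha> (fst v)) (\<Phi> v) \<in> core"
        using Phi_core(3,4)[OF vw(1)] vw(1) by (simp_all only:)
      show "0 < fst (\<Phi> v) + of_int \<bar>signed_digit \<alpha> (fst w)\<bar>"
        "inv_branch (signed_digit \<alpha> (fst w)) (\<Phi> v) \<in> core"
        unfolding vw(3) using Phi_core(3,4)[OF vw(2)] vw(2) by (simp_all only:)
    qed
    then show "v = w"
      using Phi_core(3)[OF vw(1)] Phi_core(3)[OF vw(2)] vw(3) by metis
  qed
  show "\<Phi> ` core = core"
  proof (intro equalityI subsetI)
    fix z assume z: "z \<in> core"
    then obtain m where "odd m" "0 < fst z + of_int \<bar>m\<bar>" "inv_branch m z \<in> core"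
      using exists_inv_branch by blast
    then show "z \<in> \<Phi> ` core" using Phi_inv_branch(1)[OF z] by (intro image_eqI[of _ _ "inv_branch m z"]) auto
  qed (use Phi_core(1) in auto)
qed

text \<open>This exhibits a forward image as a countable union of preimages under Borel maps, which
  is how forward images of Borel sets are seen to be Borel.\<close>

lemma Phi_image:
  assumes "E \<subseteq> core"
  shows "\<Phi> ` E = (\<Union>m\<in>{m. odd m}. {z \<in> core. 0 < fst z + of_int \<bar>m\<bar> \<and> inv_branch m z \<in> E})"
proof (intro equalityI subsetI)
  fix z assume "z \<in> \<Phi> ` E"
  then obtain v where v: "v \<in> E" "z = \<Phi> v" by auto
  then have vd: "v \<in> core" using assms by auto
  show "z \<in> (\<Union>m\<in>{m. odd m}. {z \<in> core. 0 < fst z + of_int \<bar>m\<bar> \<and> inv_branch m z \<in> E})"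
    unfolding v(2) using Phi_core[OF vd] v(1) by (intro UN_I[of "signed_digit \<alpha> (fst v)"]) simp_all
next
  fix z assume "z \<in> (\<Union>m\<in>{m. odd m}. {z \<in> core. 0 < fst z + of_int \<bar>m\<bar> \<and> inv_branch m z \<in> E})"
  then obtain m where "odd m" "z \<in> core" "0 < fst z + of_int \<bar>m\<bar>" "inv_branch m z \<in> E" by auto
  then show "z \<in> \<Phi> ` E"
    using Phi_inv_branch(1)[of z m] by (intro image_eqI[of _ _ "inv_branch m z"]) auto
qed

end

section \<open>Invariance of the measure\<close>

lemma borel_measurable_fst_prod[measurable]:
  "fst \<in> borel_measurable (borel :: ('a::second_countable_topology \<times> 'b::second_countable_topology) measure)"
  unfolding borel_prod[symmetric] by (rule measurable_fst)

lemma nn_integral_inversion: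
  fixes f :: "real \<Rightarrow> ennreal"
  assumes f[measurable]: "f \<in> borel_measurable borel"
  shows "(\<integral>\<^sup>+x. f (1 / x) * ennreal (1 / x\<^sup>2) * indicator {0<..} x \<partial>lborel) =
    (\<integral>\<^sup>+x. f x * indicator {0<..} x \<partial>lborel)"
proof -
  \<comment> \<open>These compact intervals exhaust the half-line and are invariant under inversion.
    The offset 2 makes even the first one nondegenerate.\<close>
  define J :: "nat \<Rightarrow> real set" where "J n = {1 / (real n + 2)..real n + 2}" for n
  have J_sets: "range J \<subseteq> sets lborel" by (auto simp: J_def)
  have "incseq J" unfolding J_def by (intro incseq_SucI) (auto intro!: frac_le)
  have J_UN: "(\<Union>n. J n) = {0<..}"
  proof (intro equalityI subsetI)
    fix x assume "x \<in> (\<Union>n. J n)"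
    then obtain n where "1 / (real n + 2) \<le> x" by (auto simp: J_def)
    moreover have "0 < 1 / (real n + 2)" by simp
    ultimately show "x \<in> {0<..}" by (metis greaterThan_iff less_le_trans)
  next
    fix x :: real assume x: "x \<in> {0<..}"
    obtain n where n: "max x (1 / x) < real n" using reals_Archimedean2 by blast
    then have "1 < x * real n" using x by (simp add: field_simps)
    then have "1 / (real n + 2) \<le> x" using x by (simp add: field_simps)
    then have "x \<in> J n" using n by (auto simp: J_def)
    then show "x \<in> (\<Union>n. J n)" by blast
  qed
  have exhaust: "(SUP n. \<integral>\<^sup>+x. h x * indicator (J n) x \<partial>lborel) = (\<integral>\<^sup>+x. h x * indicator {0<..} x \<partial>lborel)"
    if [measurable]: "h \<in> borel_measurable borel" for h :: "real \<Rightarrow> ennreal"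
  proof -
    have "(SUP n. emeasure (density lborel h) (J n)) = emeasure (density lborel h) (\<Union>n. J n)"
      using J_sets \<open>incseq J\<close> by (intro SUP_emeasure_incseq) auto
    moreover have "J n \<in> sets lborel" for n using J_sets by auto
    ultimately show ?thesis by (simp add: emeasure_density J_UN)
  qed
  have "(\<integral>\<^sup>+x. f x * indicator (J n) x \<partial>lborel) =
    (\<integral>\<^sup>+x. f (1 / x) * ennreal (1 / x\<^sup>2) * indicator (J n) x \<partial>lborel)" for n
  proof -
    define c where "c = real n + 2"
    \<comment> \<open>The substitution rule wants an increasing map, so -1 / x is used on the
      negative axis and the reflection is undone afterwards.\<close>
    let ?a = "- c" and ?b = "- (1 / c)"
    have c: "1 < c" by (simp add: c_def)
    have "1 / c < 1" using c by simp
    then have "1 / c < c" using c by linarith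
    then have "(\<integral>\<^sup>+x. f x * indicator {- 1 / ?a..- 1 / ?b} x \<partial>lborel) =
      (\<integral>\<^sup>+x. f (- 1 / x) * ennreal (1 / x\<^sup>2) * indicator {?a..?b} x \<partial>lborel)"
    proof (intro nn_integral_substitution_aux[of f ?a ?b "\<lambda>x. - 1 / x" "\<lambda>x. 1 / x\<^sup>2"])
      fix x assume "x \<in> {?a..?b}"
      moreover have "?b < 0" using c by simp
      ultimately have "x \<noteq> 0" by (auto simp del: neg_less_0_iff_less)
      then show "((\<lambda>x. - 1 / x) has_real_derivative 1 / x\<^sup>2) (at x)"
        by (auto intro!: derivative_eq_intros simp: power2_eq_square)
    next
      have "?b < 0" using c by simp
      then show "continuous_on {?a..?b} (\<lambda>x. 1 / x\<^sup>2)"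
        by (intro continuous_intros) (auto simp del: neg_less_0_iff_less)
    qed auto
    also have "\<dots> = (\<integral>\<^sup>+x. f (1 / x) * ennreal (1 / x\<^sup>2) * indicator (J n) x \<partial>lborel)"
      by (subst nn_integral_real_affine[where c = "-1" and t = 0])
         (auto simp: J_def c_def[symmetric] indicator_def intro!: nn_integral_cong)
    finally show ?thesis by (simp add: J_def c_def[symmetric])
  qed
  then show ?thesis
    using exhaust[of f] exhaust[of "\<lambda>x. f (1 / x) * ennreal (1 / x\<^sup>2)"] by simp
qed

text \<open>The branch is composed of the reflection by \<open>s\<close>, the inversion and a
  translation by \<open>k\<close>; only the inversion contributes a Jacobian.\<close>

lemma nn_integral_base_branch:
  fixes f :: "real \<Rightarrow> ennreal" and k s :: real
  assumes f[measurable]: "f \<in> borel_measurable borel" and s: "\<bar>s\<bar> = 1"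
  shows "(\<integral>\<^sup>+x. f (s / x - k) * ennreal (1 / x\<^sup>2) * indicator {x. 0 < s * x} x \<partial>lborel) =
    (\<integral>\<^sup>+x. f x * indicator {x. 0 < x + k} x \<partial>lborel)"
proof -
  have s': "s = 1 \<or> s = -1" using s by linarith
  have "(\<integral>\<^sup>+x. f (s / x - k) * ennreal (1 / x\<^sup>2) * indicator {x. 0 < s * x} x \<partial>lborel) =
    (\<integral>\<^sup>+x. f (1 / x - k) * ennreal (1 / x\<^sup>2) * indicator {0<..} x \<partial>lborel)"
    using s'
    by (subst nn_integral_real_affine[where c = s and t = 0])
       (auto simp: indicator_def intro!: nn_integral_cong)
  also have "\<dots> = (\<integral>\<^sup>+x. f (x - k) * indicator {0<..} x \<partial>lborel)"
    by (rule nn_integral_inversion) measurable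
  also have "\<dots> = (\<integral>\<^sup>+x. f x * indicator {x. 0 < x + k} x \<partial>lborel)"
    by (subst nn_integral_real_affine[where c = 1 and t = k])
       (auto simp: indicator_def add.commute intro!: nn_integral_cong)
  finally show ?thesis .
qed

lemma nn_integral_fibre_branch:
  fixes f :: "real \<Rightarrow> ennreal" and k s :: real
  assumes f[measurable]: "f \<in> borel_measurable borel" and s: "\<bar>s\<bar> = 1"
  shows "(\<integral>\<^sup>+y. f (1 / (k + s * y)) * ennreal (1 / (k + s * y)\<^sup>2) * indicator {y. 0 < k + s * y} y \<partial>lborel) =
    (\<integral>\<^sup>+y. f y * indicator {0<..} y \<partial>lborel)"
proof -
  have s': "s = 1 \<or> s = -1" using s by linarith
  have "(\<integral>\<^sup>+y. f y * indicator {0<..} y \<partial>lborel) =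
    (\<integral>\<^sup>+x. f (1 / x) * ennreal (1 / x\<^sup>2) * indicator {0<..} x \<partial>lborel)"
    by (rule nn_integral_inversion[symmetric]) measurable
  also have "\<dots> = (\<integral>\<^sup>+y. f (1 / (k + s * y)) * ennreal (1 / (k + s * y)\<^sup>2) * indicator {y. 0 < k + s * y} y \<partial>lborel)"
    using s' by (subst nn_integral_real_affine[where c = s and t = k])
       (auto simp: indicator_def intro!: nn_integral_cong)
  finally show ?thesis ..
qed

lemma nn_integral_lborel_pair:
  fixes g :: "real \<times> real \<Rightarrow> ennreal"
  assumes "g \<in> borel_measurable borel"
  shows "(\<integral>\<^sup>+z. g z \<partial>lborel) = (\<integral>\<^sup>+x. \<integral>\<^sup>+y. g (x, y) \<partial>lborel \<partial>lborel)"
  using lborel.nn_integral_fst[of g lborel] assms by (simp add: lborel_prod)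

text \<open>With sign and digit fixed, a branch acts on the two coordinates separately, so Tonelli
  reduces it to the two one-dimensional substitutions.\<close>

lemma nn_integral_plane_branch:
  fixes F :: "real \<times> real \<Rightarrow> ennreal" and k s :: real
  assumes F: "F \<in> borel_measurable borel" and s: "\<bar>s\<bar> = 1"
  shows "(\<integral>\<^sup>+(x, y). F (s / x - k, 1 / (k + s * y)) *
      (ennreal (1 / x\<^sup>2) * ennreal (1 / (k + s * y)\<^sup>2)) *
      (indicator {x. 0 < s * x} x * indicator {y. 0 < k + s * y} y) \<partial>lborel) =
    (\<integral>\<^sup>+(x, y). F (x, y) * (indicator {x. 0 < x + k} x * indicator {0<..} y) \<partial>lborel)"
    (is "?L = ?R")
proof -
  have F'[measurable]: "F \<in> borel_measurable (borel \<Otimes>\<^sub>M borel)" using F by (simp add: borel_prod)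
  define f where "f x = (\<integral>\<^sup>+y. F (x, y) * indicator {0<..} y \<partial>lborel)" for x
  have f[measurable]: "f \<in> borel_measurable borel" unfolding f_def by measurable
  have "?L = (\<integral>\<^sup>+x. \<integral>\<^sup>+y. F (s / x - k, 1 / (k + s * y)) *
      (ennreal (1 / x\<^sup>2) * ennreal (1 / (k + s * y)\<^sup>2)) *
      (indicator {x. 0 < s * x} x * indicator {y. 0 < k + s * y} y) \<partial>lborel \<partial>lborel)"
  proof (subst nn_integral_lborel_pair)
    show "(\<lambda>(x, y). F (s / x - k, 1 / (k + s * y)) *
      (ennreal (1 / x\<^sup>2) * ennreal (1 / (k + s * y)\<^sup>2)) *
      (indicator {x. 0 < s * x} x * indicator {y. 0 < k + s * y} y)) \<in> borel_measurable borel"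
      unfolding borel_prod[symmetric] by measurable
  qed (simp only: prod.case)
  also have "\<dots> = (\<integral>\<^sup>+x. f (s / x - k) * ennreal (1 / x\<^sup>2) * indicator {x. 0 < s * x} x \<partial>lborel)"
  proof (rule nn_integral_cong)
    fix x :: real
    have "(\<integral>\<^sup>+y. F (s / x - k, 1 / (k + s * y)) *
      (ennreal (1 / x\<^sup>2) * ennreal (1 / (k + s * y)\<^sup>2)) *
      (indicator {x. 0 < s * x} x * indicator {y. 0 < k + s * y} y) \<partial>lborel) =
      (\<integral>\<^sup>+y. (ennreal (1 / x\<^sup>2) * indicator {x. 0 < s * x} x) *
       (F (s / x - k, 1 / (k + s * y)) * ennreal (1 / (k + s * y)\<^sup>2) * indicator {y. 0 < k + s * y} y) \<partial>lborel)"
      by (intro nn_integral_cong) (simp only: ac_simps)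
    also have "\<dots> = (ennreal (1 / x\<^sup>2) * indicator {x. 0 < s * x} x) *
      (\<integral>\<^sup>+y. F (s / x - k, 1 / (k + s * y)) * ennreal (1 / (k + s * y)\<^sup>2) * indicator {y. 0 < k + s * y} y \<partial>lborel)"
      by (rule nn_integral_cmult) measurable
    also have "(\<integral>\<^sup>+y. F (s / x - k, 1 / (k + s * y)) * ennreal (1 / (k + s * y)\<^sup>2) * indicator {y. 0 < k + s * y} y \<partial>lborel) =
      f (s / x - k)"
      unfolding f_def by (rule nn_integral_fibre_branch[OF _ s]) measurable
    finally show "(\<integral>\<^sup>+y. F (s / x - k, 1 / (k + s * y)) *
      (ennreal (1 / x\<^sup>2) * ennreal (1 / (k + s * y)\<^sup>2)) *
      (indicator {x. 0 < s * x} x * indicator {y. 0 < k + s * y} y) \<partial>lborel) =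
      f (s / x - k) * ennreal (1 / x\<^sup>2) * indicator {x. 0 < s * x} x"
      by (simp only: ac_simps)
  qed
  also have "\<dots> = (\<integral>\<^sup>+x. f x * indicator {x. 0 < x + k} x \<partial>lborel)"
    by (rule nn_integral_base_branch[OF f s])
  also have "\<dots> = (\<integral>\<^sup>+x. \<integral>\<^sup>+y. F (x, y) * (indicator {x. 0 < x + k} x * indicator {0<..} y) \<partial>lborel \<partial>lborel)"
  proof (rule nn_integral_cong)
    fix x
    have "(\<integral>\<^sup>+y. F (x, y) * indicator {0<..} y * indicator {x. 0 < x + k} x \<partial>lborel) =
      f x * indicator {x. 0 < x + k} x"
      unfolding f_def by (rule nn_integral_multc) measurable
    then show "f x * indicator {x. 0 < x + k} x =
      (\<integral>\<^sup>+y. F (x, y) * (indicator {x. 0 < x + k} x * indicator {0<..} y) \<partial>lborel)"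
      by (simp only: ac_simps)
  qed
  also have "\<dots> = ?R"
  proof (subst nn_integral_lborel_pair)
    show "(\<lambda>(x, y). F (x, y) * (indicator {x. 0 < x + k} x * indicator {0<..} y)) \<in> borel_measurable borel"
      unfolding borel_prod[symmetric] by measurable
  qed (simp only: prod.case)
  finally show ?thesis .
qed

text \<open>The unnormalised measure on the whole plane, so that invariance can be proved before any
  restriction to the domain or scaling.\<close>

definition moebius_measure :: "(real \<times> real) measure" where
  "moebius_measure = density lborel (\<lambda>(x, y). ennreal (1 / (1 + x * y)\<^sup>2))"

lemma sets_moebius_measure[simp, measurable_cong]: "sets moebius_measure = sets borel"
  by (simp add: moebius_measure_def)

lemma moebius_density_measurable[measurable]:
  "(\<lambda>(x, y). ennreal (1 / (1 + x * y)\<^sup>2)) \<in> borel_measurable (borel :: (real \<times> real) measure)"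
  unfolding borel_prod[symmetric] by measurable

lemma signed_digit_measurable[measurable]: "signed_digit \<alpha> \<in> measurable borel (count_space UNIV)"
  unfolding signed_digit_def d_alpha_def by measurable

lemma phi_alpha_measurable[measurable]: "phi_alpha \<alpha> \<in> borel_measurable borel"
  unfolding phi_alpha_def d_alpha_def by measurable

lemma Phi_alpha_measurable[measurable]: "Phi_alpha \<alpha> \<in> measurable borel borel"
  unfolding Phi_alpha_def d_alpha_def borel_prod[symmetric] by measurable

lemma inv_branch_measurable[measurable]: "inv_branch m \<in> measurable borel borel"
  unfolding inv_branch_def borel_prod[symmetric] by measurable

text \<open>With d the denominator of the second coordinate, squaring this for s = 1 or s = -1
  produces the Jacobian 1 / (x * d)^2, so the density is invariant.\<close>

lemma one_plus_branch_product:
  fixes x y s d :: real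
  assumes "x \<noteq> 0" "d \<noteq> 0"
  shows "1 + (s / x - (d - s * y)) * (1 / d) = s * (1 + x * y) / (x * d)"
  using assms by (simp add: field_simps)

section \<open>Invariance on the domain \<open>core\<close>\<close>

context odd_alpha
begin

lemma core_sets[measurable]: "core \<in> sets borel"
proof -
  have [measurable]: "K \<in> sets borel"
    using countable_param_field sets.countable[of K borel] by auto
  have "Measurable.pred (borel \<Otimes>\<^sub>M borel) (\<lambda>(x, y). x \<notin> K \<and> y \<notin> K \<and> \<alpha> - 2 < x \<and> x < \<alpha> \<and> 0 < y \<and> y < G \<and>
     (2 - G < y \<and> y < 1 \<longrightarrow> 1 - \<alpha> < \<alpha> * x) \<and> (1 < y \<longrightarrow> \<alpha> - 1 < (2 - \<alpha>) * x))"
    by measurable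
  then show ?thesis unfolding core_def borel_prod[symmetric] pred_def by (simp add: space_pair_measure)
qed

lemma Phi_image_sets:
  assumes [measurable]: "E \<in> sets borel" and "E \<subseteq> core"
  shows "\<Phi> ` E \<in> sets borel"
proof -
  have "{z \<in> core. 0 < fst z + of_int \<bar>m\<bar> \<and> inv_branch m z \<in> E} \<in> sets borel" for m
  proof -
    have "Measurable.pred borel (\<lambda>z. z \<in> core \<and> 0 < fst z + of_int \<bar>m\<bar> \<and> inv_branch m z \<in> E)"
      by measurable
    then show ?thesis by (simp add: pred_def)
  qed
  then show ?thesis unfolding Phi_image[OF assms(2)] by (intro sets.countable_UN') auto
qed

lemma branch_image_measure:
  assumes E[measurable]: "E \<in> sets borel" and sub: "E \<subseteq> {z \<in> core. signed_digit \<alpha> (fst z) = m}"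
    and m: "odd m"
  shows "emeasure moebius_measure (\<Phi> ` E) = emeasure moebius_measure E"
proof -
  define s k where "s = real_of_int (sgn m)" and "k = real_of_int \<bar>m\<bar>"
  let ?h = "\<lambda>(x, y). ennreal (1 / (1 + x * y)\<^sup>2)"
  have Ed: "E \<subseteq> core" using sub by auto
  have m0: "m \<noteq> 0" using m by auto
  have s: "\<bar>s\<bar> = 1" "s * s = 1" "s \<noteq> 0" using m0 by (auto simp: s_def sgn_if)
  note [measurable] = Phi_image_sets[OF E Ed]
  \<comment> \<open>The formal branch is considered on whole half-planes, beyond \<open>E\<close>.
    Membership transfers because \<open>inv_branch m\<close> undoes both the formula and the true
    map on \<open>E\<close>.\<close>
  have iso: "(s / x - k, 1 / (k + s * y)) \<in> \<Phi> ` E \<longleftrightarrow> (x, y) \<in> E" if "0 < s * x" "0 < k + s * y" for x y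
  proof -
    have dg: "signed_digit \<alpha> (fst v) = m" "inv_branch m (\<Phi> v) = v" if "v \<in> E" for v
      using Phi_core(3)[of v] sub that by auto
    have "inv_branch m (s / x - k, 1 / (k + s * y)) = (x, y)"
      unfolding inv_branch_def prod.case s_def[symmetric] k_def[symmetric]
      using that s by (simp add: mult.assoc[symmetric])
    moreover have "\<Phi> (x, y) = (s / x - k, 1 / (k + s * y))" if "(x, y) \<in> E"
    proof -
      have "signed_digit \<alpha> x = m" "1 \<le> dg x" "x \<noteq> 0" using dg(1)[OF that] that Ed dg_pos core_nonzero
        by (auto simp: core_def)
      then show ?thesis unfolding s_def k_def
        by (auto simp: Phi_alpha_def phi_alpha_def signed_digit_def split: if_splits)
    qed
    ultimately show ?thesis
      using dg(2) by (auto intro!: image_eqI[of _ _ "(x, y)"])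
  qed
  have pos: "0 < s * x \<and> 0 < k + s * y" if "(x, y) \<in> E" for x y
  proof -
    have d: "(x, y) \<in> core" and sd: "signed_digit \<alpha> x = m" using that sub by auto
    have "x \<noteq> 0" "1 \<le> dg x" "0 < y" using d dg_pos core_nonzero by (auto simp: core_def)
    then show ?thesis using sd core_image_neg(2)[OF d]
      by (auto simp: s_def k_def signed_digit_def sgn_if split: if_splits intro: add_pos_pos)
  qed
  have "emeasure moebius_measure (\<Phi> ` E) = (\<integral>\<^sup>+z. ?h z * indicator (\<Phi> ` E) z \<partial>lborel)"
    unfolding moebius_measure_def by (rule emeasure_density) simp_all
  also have "\<dots> = (\<integral>\<^sup>+(x, y). (?h (x, y) * indicator (\<Phi> ` E) (x, y)) * (indicator {x. 0 < x + k} x * indicator {0<..} y) \<partial>lborel)"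
  proof (rule nn_integral_cong)
    fix z :: "real \<times> real"
    obtain x y where z: "z = (x, y)" by (cases z)
    have "0 < x + k" "0 < y" if "(x, y) \<in> \<Phi> ` E"
    proof -
      obtain v where v: "v \<in> E" "\<Phi> v = (x, y)" using \<open>(x, y) \<in> \<Phi> ` E\<close> by auto
      then have "v \<in> core" "signed_digit \<alpha> (fst v) = m" using sub by auto
      then show "0 < x + k" "0 < y" using Phi_core(1,4)[of v] v by (auto simp: core_def k_def)
    qed
    then show "?h z * indicator (\<Phi> ` E) z = (case z of (x, y) \<Rightarrow>
      (?h (x, y) * indicator (\<Phi> ` E) (x, y)) * (indicator {x. 0 < x + k} x * indicator {0<..} y))"
      unfolding z prod.case by (auto simp: indicator_def)
  qed
  also have "\<dots> = (\<integral>\<^sup>+(x, y). (?h (s / x - k, 1 / (k + s * y)) * indicator (\<Phi> ` E) (s / x - k, 1 / (k + s * y))) *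
      (ennreal (1 / x\<^sup>2) * ennreal (1 / (k + s * y)\<^sup>2)) *
      (indicator {x. 0 < s * x} x * indicator {y. 0 < k + s * y} y) \<partial>lborel)"
    by (rule nn_integral_plane_branch[symmetric, OF _ s(1)]) measurable
  also have "\<dots> = (\<integral>\<^sup>+z. ?h z * indicator E z \<partial>lborel)"
  proof (rule nn_integral_cong)
    fix z :: "real \<times> real"
    obtain x y where z: "z = (x, y)" by (cases z)
    have "(?h (s / x - k, 1 / (k + s * y)) * indicator (\<Phi> ` E) (s / x - k, 1 / (k + s * y))) *
      (ennreal (1 / x\<^sup>2) * ennreal (1 / (k + s * y)\<^sup>2)) *
      (indicator {x. 0 < s * x} x * indicator {y. 0 < k + s * y} y) = ?h (x, y) * indicator E (x, y)"
    proof (cases "0 < s * x \<and> 0 < k + s * y")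
      case True
      have "x \<noteq> 0" "k + s * y \<noteq> 0" using True by auto
      then have "1 + (s / x - ((k + s * y) - s * y)) * (1 / (k + s * y)) = s * (1 + x * y) / (x * (k + s * y))"
        by (rule one_plus_branch_product)
      then have "1 + (s / x - k) * (1 / (k + s * y)) = s * (1 + x * y) / (x * (k + s * y))" by simp
      then have "(1 + (s / x - k) * (1 / (k + s * y)))\<^sup>2 = (1 + x * y)\<^sup>2 / (x\<^sup>2 * (k + s * y)\<^sup>2)"
        using s(2) by (simp add: power_divide power_mult_distrib power2_eq_square[of s])
      then have "1 / (1 + (s / x - k) * (1 / (k + s * y)))\<^sup>2 * (1 / x\<^sup>2 * (1 / (k + s * y)\<^sup>2)) = 1 / (1 + x * y)\<^sup>2"
        using \<open>x \<noteq> 0\<close> \<open>k + s * y \<noteq> 0\<close> by simp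
      then have "?h (s / x - k, 1 / (k + s * y)) * (ennreal (1 / x\<^sup>2) * ennreal (1 / (k + s * y)\<^sup>2)) = ?h (x, y)"
        by (simp add: ennreal_mult[symmetric])
      then show ?thesis using True iso[of x y]
        by (auto simp: indicator_def)
    next
      case False
      then show ?thesis using pos[of x y] by (auto simp: indicator_def)
    qed
    then show "(case z of (x, y) \<Rightarrow> (?h (s / x - k, 1 / (k + s * y)) * indicator (\<Phi> ` E) (s / x - k, 1 / (k + s * y))) *
      (ennreal (1 / x\<^sup>2) * ennreal (1 / (k + s * y)\<^sup>2)) *
      (indicator {x. 0 < s * x} x * indicator {y. 0 < k + s * y} y)) = ?h z * indicator E z"
      unfolding z prod.case .
  qed
  also have "\<dots> = emeasure moebius_measure E"
    unfolding moebius_measure_def by (rule emeasure_density[symmetric]) simp_all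
  finally show ?thesis .
qed

text \<open>The set splits into countably many classes of constant odd signed digit, and injectivity
  keeps their images disjoint.\<close>

lemma Phi_image_measure:
  assumes E[measurable]: "E \<in> sets borel" and sub: "E \<subseteq> core"
  shows "emeasure moebius_measure (\<Phi> ` E) = emeasure moebius_measure E"
proof -
  define B where "B m = {z \<in> E. signed_digit \<alpha> (fst z) = m}" for m
  have B[measurable]: "B m \<in> sets borel" for m
  proof -
    have "Measurable.pred borel (\<lambda>z. z \<in> E \<and> signed_digit \<alpha> (fst z) = m)"
      by measurable
    then show ?thesis by (simp add: pred_def B_def)
  qed
  have Bd: "B m \<subseteq> core" for m using sub by (auto simp: B_def)
  have EB: "E = (\<Union>m\<in>{m. odd m}. B m)" using Phi_core(2) sub by (auto simp: B_def)
  have "emeasure moebius_measure (\<Union>m\<in>{m. odd m}. \<Phi> ` B m) =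
    (\<integral>\<^sup>+m. emeasure moebius_measure (\<Phi> ` B m) \<partial>count_space {m. odd m})"
  proof (rule emeasure_UN_countable)
    have "\<Phi> ` B m \<inter> \<Phi> ` B n = \<Phi> ` (B m \<inter> B n)" for m n
      using bij_Phi Bd by (intro inj_on_image_Int[symmetric]) (auto simp: bij_betw_def)
    then show "disjoint_family_on (\<lambda>m. \<Phi> ` B m) {m. odd m}"
      by (auto simp: disjoint_family_on_def B_def)
  qed (use Phi_image_sets[OF B Bd] in auto)
  also have "\<dots> = (\<integral>\<^sup>+m. emeasure moebius_measure (B m) \<partial>count_space {m. odd m})"
  proof (rule nn_integral_cong)
    fix m assume "m \<in> space (count_space {m :: int. odd m})"
    then show "emeasure moebius_measure (\<Phi> ` B m) = emeasure moebius_measure (B m)"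
      using sub by (intro branch_image_measure[OF B]) (auto simp: B_def)
  qed
  also have "\<dots> = emeasure moebius_measure (\<Union>m\<in>{m. odd m}. B m)"
  proof (rule emeasure_UN_countable[symmetric])
    show "disjoint_family_on B {m. odd m}" by (auto simp: disjoint_family_on_def B_def)
  qed (use B in auto)
  finally show ?thesis unfolding image_UN[symmetric] EB[symmetric] .
qed

end

section \<open>The extension property\<close>

lemma emeasure_mu_tilde_alpha:
  assumes \<Omega>: "Omega_alpha \<alpha> \<in> sets borel" and S: "S \<in> sets borel" "S \<subseteq> Omega_alpha \<alpha>"
  shows "emeasure (mu_tilde_alpha \<alpha>) S = ennreal (1 / (3 * ln gold_G)) * emeasure moebius_measure S"
proof -
  let ?h = "\<lambda>(x, y). ennreal (1 / (1 + x * y)\<^sup>2)"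
  have h: "?h \<in> borel_measurable (restrict_space lborel (Omega_alpha \<alpha>))"
    by (intro measurable_restrict_space1) simp
  have S': "S \<in> sets (restrict_space lborel (Omega_alpha \<alpha>))"
    using S \<Omega> by (simp add: sets_restrict_space_iff)
  have "emeasure (mu_alpha \<alpha>) S = (\<integral>\<^sup>+z. ?h z * indicator S z \<partial>restrict_space lborel (Omega_alpha \<alpha>))"
    unfolding mu_alpha_def by (rule emeasure_density[OF h S'])
  also have "\<dots> = (\<integral>\<^sup>+z. ?h z * indicator S z * indicator (Omega_alpha \<alpha>) z \<partial>lborel)"
    using \<Omega> by (subst nn_integral_restrict_space) auto
  also have "\<dots> = (\<integral>\<^sup>+z. ?h z * indicator S z \<partial>lborel)"
    using S(2) by (intro nn_integral_cong) (auto simp: indicator_def)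
  also have "\<dots> = emeasure moebius_measure S"
    unfolding moebius_measure_def using S by (intro emeasure_density[symmetric]) simp_all
  finally show ?thesis by (simp add: mu_tilde_alpha_def)
qed

lemma space_mu_tilde_alpha: "space (mu_tilde_alpha \<alpha>) = Omega_alpha \<alpha>"
  by (simp add: mu_tilde_alpha_def mu_alpha_def space_restrict_space space_scale_measure)

lemma sets_mu_tilde_alpha:
  assumes "Omega_alpha \<alpha> \<in> sets borel"
  shows "S \<in> sets (mu_tilde_alpha \<alpha>) \<longleftrightarrow> S \<in> sets borel \<and> S \<subseteq> Omega_alpha \<alpha>"
  using assms by (auto simp: mu_tilde_alpha_def mu_alpha_def sets_restrict_space_iff)

lemma gold_g_less_G: "gold_g < gold_G"
  by (simp add: gold_g_eq)

section \<open>Comparison of \<open>core\<close> with the given domain\<close>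

context odd_alpha
begin

abbreviation "\<Omega> \<equiv> Omega_alpha \<alpha>"
abbreviation "\<mu> \<equiv> mu_tilde_alpha \<alpha>"
abbreviation "\<nu> \<equiv> nu_alpha \<alpha>"

text \<open>Dividing by 2 - \<alpha> shows that the left end of the top strip lies to the right of
  \<alpha> - 2.\<close>

lemma alpha_quad_shift: "0 < (2 - \<alpha>) * (2 - \<alpha>) + (\<alpha> - 1)"
proof -
  have "(2 - \<alpha>) * (2 - \<alpha>) + (\<alpha> - 1) = (\<alpha> - 3 / 2)\<^sup>2 + 3 / 4"
    by (simp add: power2_eq_square algebra_simps)
  then show ?thesis using zero_le_power2[of "\<alpha> - 3 / 2"] by linarith
qed

text \<open>Both endpoints have digit 1 for \<alpha> strictly inside. At \<alpha> = g the digit of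
  \<alpha>, and at \<alpha> = G the digit of \<alpha> - 2, jumps to 3, which is why strict versions
  of \<open>alpha_quad\<close> are derived.\<close>

lemma phi_endpoints:
  assumes "\<alpha> \<noteq> gold_g" "\<alpha> \<noteq> G"
  shows "\<phi> \<alpha> = 1 / \<alpha> - 1" "\<phi> (\<alpha> - 2) = (\<alpha> - 1) / (2 - \<alpha>)"
proof -
  have a: "0 < \<alpha>" "\<alpha> < 2" using alpha_bounds by auto
  have "gold_g * gold_g < \<alpha> * \<alpha>"
    using assms(1) alpha_ge gold_g_eq gold_G_bounds by (intro mult_strict_mono) auto
  moreover have "gold_g * gold_g = 1 - gold_g"
    using gold_G_square unfolding gold_g_eq by (simp add: algebra_simps)
  ultimately have q1: "1 < \<alpha> * \<alpha> + \<alpha>" using alpha_ge by simp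
  have "\<alpha> * \<alpha> < G * G" using assms(2) alpha_le alpha_bounds gold_G_bounds by (intro mult_strict_mono) auto
  moreover have "(G - \<alpha>) * (\<alpha> + (G - 1)) > 0"
    using alpha_le assms(2) alpha_bounds gold_G_bounds by (intro mult_pos_pos) auto
  ultimately have q2: "\<alpha> * \<alpha> < \<alpha> + 1"
    using gold_G_square by (simp add: algebra_simps)
  have "1 / \<alpha> < \<alpha> + 1" "\<alpha> - 1 \<le> 1 / \<alpha>"
    using a q1 q2 by (auto simp: field_simps)
  then have "dg \<alpha> = 1" using a by (intro d_alpha_eqI) auto
  then show "\<phi> \<alpha> = 1 / \<alpha> - 1" using a by (simp add: phi_alpha_def)
  have abs: "\<bar>\<alpha> - 2\<bar> = 2 - \<alpha>" using a by simp
  have "1 / (2 - \<alpha>) < \<alpha> + 1" using a q2 by (simp add: field_simps)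
  moreover have "\<alpha> - 1 \<le> 1 / (2 - \<alpha>)" using alpha_quad_shift a by (simp add: field_simps)
  ultimately have "dg (\<alpha> - 2) = 1" by (intro d_alpha_eqI) (auto simp: abs)
  then show "\<phi> (\<alpha> - 2) = (\<alpha> - 1) / (2 - \<alpha>)" using a abs
    by (simp add: phi_alpha_def field_simps)
qed

text \<open>The strip boundaries have coordinates in \<open>K\<close>, so the choice between open
  and closed ends is invisible here. What remains is to match the thresholds in the three cases of
  the definition.\<close>

lemma Omega_iff_core:
  assumes "x \<notin> K" "y \<notin> K"
  shows "(x, y) \<in> \<Omega> \<longleftrightarrow> (x, y) \<in> core"
proof -
  have a: "0 < \<alpha>" "\<alpha> < 2" using alpha_bounds by auto
  have "0 \<in> K" "1 \<in> K" "2 - G \<in> K" "\<alpha> - 2 \<in> K" "G \<in> K" "1 / \<alpha> - 1 \<in> K" "(\<alpha> - 1) / (2 - \<alpha>) \<in> K"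
    by (intro param_field_intros)+
  then have ne: "y \<noteq> 0" "y \<noteq> 1" "y \<noteq> 2 - G" "x \<noteq> \<alpha> - 2" "x \<noteq> (\<alpha> - 1) / (2 - \<alpha>)"
    using assms by auto
  have b: "\<alpha> - 1 < (2 - \<alpha>) * x \<longleftrightarrow> (\<alpha> - 1) / (2 - \<alpha>) < x" using a by (simp add: field_simps)
  have c: "1 - \<alpha> < \<alpha> * x \<longleftrightarrow> 1 / \<alpha> - 1 < x" using a by (simp add: field_simps)
  have bl: "\<alpha> - 2 < (\<alpha> - 1) / (2 - \<alpha>)" using alpha_quad_shift a by (simp add: field_simps)
  have cl: "\<alpha> - 2 \<le> 1 / \<alpha> - 1" using alpha_quad a by (simp add: field_simps)
  have g: "G - 1 > 0" "2 - G > 0" "2 - G < 1" "1 < G" using gold_G_bounds by auto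
  have D: "(x, y) \<in> core \<longleftrightarrow> \<alpha> - 2 < x \<and> x < \<alpha> \<and> 0 < y \<and> y < G \<and>
     (2 - G < y \<and> y < 1 \<longrightarrow> 1 / \<alpha> - 1 < x) \<and> (1 < y \<longrightarrow> (\<alpha> - 1) / (2 - \<alpha>) < x)"
    using assms unfolding core_def by (simp add: b c)
  define b c where "b = (\<alpha> - 1) / (2 - \<alpha>)" and "c = 1 / \<alpha> - 1"
  note fold = b_def[symmetric] c_def[symmetric]
  note D = D[unfolded fold] and ne = ne[unfolded fold] and bl = bl[unfolded fold] and cl = cl[unfolded fold]
  have zone: "(y < 2 - G) \<or> (2 - G < y \<and> y < 1) \<or> 1 < y" using ne by linarith
  consider "\<alpha> = gold_g" | "\<alpha> = G" | "\<alpha> \<noteq> gold_g" "\<alpha> \<noteq> G" by auto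
  then show ?thesis
  proof cases
    case 1
    \<comment> \<open>The middle strip degenerates, since 1 / g - 1 = g.\<close>
    have c: "c = \<alpha>" using gold_G_square g unfolding c_def 1 gold_g_eq by (simp add: field_simps)
    have g': "1 - gold_g = 2 - G" unfolding gold_g_eq by simp
    have "\<Omega> = {\<alpha> - 2..<\<alpha>} \<times> {0..<2 - G} \<union> {b..<\<alpha>} \<times> {1..<G}"
      unfolding Omega_alpha_def b_def 1 g' by simp
    then have O: "(x, y) \<in> \<Omega> \<longleftrightarrow> (\<alpha> - 2 \<le> x \<and> x < \<alpha> \<and> 0 \<le> y \<and> y < 2 - G) \<or>
        (b \<le> x \<and> x < \<alpha> \<and> 1 \<le> y \<and> y < G)"
      by simp
    from zone show ?thesis unfolding D O c using ne bl g by (elim disjE conjE) auto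
  next
    case 2
    \<comment> \<open>Here the middle condition holds throughout the base interval, while the top
      strip is empty because b = \<alpha>.\<close>
    have c: "c = \<alpha> - 2" unfolding c_def 2 inverse_gold_G by simp
    have b: "b = \<alpha>" using gold_G_square g unfolding b_def 2 by (simp add: field_simps)
    have "\<Omega> = {\<alpha> - 2..<\<alpha>} \<times> {0..<1}"
      unfolding Omega_alpha_def using gold_g_less_G by (simp add: 2)
    then have O: "(x, y) \<in> \<Omega> \<longleftrightarrow> \<alpha> - 2 \<le> x \<and> x < \<alpha> \<and> 0 \<le> y \<and> y < 1"
      by simp
    from zone show ?thesis unfolding D O b c using ne g by (elim disjE conjE) auto
  next
    case 3
    have "\<Omega> = {\<alpha> - 2..<\<alpha>} \<times> {0..<2 - G} \<union> {c<..<\<alpha>} \<times> {2 - G<..1} \<union> {b..<\<alpha>} \<times> {1..<G}"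
      unfolding Omega_alpha_def I_alpha_def b_def c_def using 3 by (simp add: phi_endpoints)
    then have O: "(x, y) \<in> \<Omega> \<longleftrightarrow> (\<alpha> - 2 \<le> x \<and> x < \<alpha> \<and> 0 \<le> y \<and> y < 2 - G) \<or>
        (c < x \<and> x < \<alpha> \<and> 2 - G < y \<and> y \<le> 1) \<or> (b \<le> x \<and> x < \<alpha> \<and> 1 \<le> y \<and> y < G)"
      by simp
    from zone show ?thesis unfolding D O using ne bl cl g by (elim disjE conjE) auto
  qed
qed

lemma Omega_sets: "\<Omega> \<in> sets borel"
  unfolding Omega_alpha_def I_alpha_def borel_prod[symmetric] by auto

lemma Omega_fst: "z \<in> \<Omega> \<Longrightarrow> fst z \<in> I_alpha \<alpha>"
proof -
  have a: "0 < \<alpha>" "\<alpha> < 2" using alpha_bounds by auto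
  have bl: "\<alpha> - 2 < (\<alpha> - 1) / (2 - \<alpha>)" using alpha_quad_shift a by (simp add: field_simps)
  have cl: "\<alpha> - 2 \<le> 1 / \<alpha> - 1" using alpha_quad a by (simp add: field_simps)
  show "z \<in> \<Omega> \<Longrightarrow> fst z \<in> I_alpha \<alpha>"
    using bl cl phi_endpoints unfolding Omega_alpha_def I_alpha_def by (auto split: if_splits)
qed

lemma core_subset_Omega: "core \<subseteq> \<Omega>"
proof
  fix z assume "z \<in> core"
  then show "z \<in> \<Omega>" using Omega_iff_core[of "fst z" "snd z"] by (cases z) (auto simp: core_def)
qed

text \<open>The difference is covered by countably many horizontal and vertical lines, which are
  Lebesgue null and hence null for the density.\<close>

lemma null_Omega_minus_core: "\<Omega> - core \<in> null_sets \<mu>"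
proof -
  have K: "K \<in> null_sets lborel"
    using countable_param_field by (rule countable_imp_null_set_lborel)
  then have Kb: "K \<in> sets borel" by auto
  have "emeasure (lborel \<Otimes>\<^sub>M lborel) (K \<times> UNIV) = 0" "emeasure (lborel \<Otimes>\<^sub>M lborel) (UNIV \<times> K) = 0"
    using K Kb by (simp_all add: lborel.emeasure_pair_measure_Times null_sets_def)
  then have "K \<times> UNIV \<in> null_sets lborel" "UNIV \<times> K \<in> null_sets lborel"
    using Kb unfolding lborel_prod[symmetric] by (auto intro!: null_setsI)
  then have "K \<times> UNIV \<union> UNIV \<times> K \<in> null_sets (lborel :: (real \<times> real) measure)" by auto
  moreover have "\<Omega> - core \<subseteq> K \<times> UNIV \<union> UNIV \<times> K"
    using Omega_iff_core by auto
  moreover have "\<Omega> - core \<in> sets borel" using Omega_sets by simp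
  ultimately have N: "\<Omega> - core \<in> null_sets lborel"
    by (metis null_sets_subset sets_lborel)
  have "emeasure moebius_measure (\<Omega> - core) = 0"
    using absolutely_continuousI_density[of "\<lambda>(x, y). ennreal (1 / (1 + x * y)\<^sup>2)" lborel] N
    unfolding absolutely_continuous_def moebius_measure_def by (auto simp: null_sets_def)
  then have "emeasure \<mu> (\<Omega> - core) = 0"
    using Omega_sets by (simp add: emeasure_mu_tilde_alpha)
  then show ?thesis using Omega_sets by (intro null_setsI) (auto simp: sets_mu_tilde_alpha)
qed

lemma sets_restrict_core:
  "S \<in> sets (restrict_space \<mu> core) \<longleftrightarrow> S \<in> sets borel \<and> S \<subseteq> core"
proof -
  have "core \<inter> space \<mu> \<in> sets \<mu>" using core_subset_Omega Omega_sets core_sets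
    by (auto simp: sets_mu_tilde_alpha space_mu_tilde_alpha Int_absorb2)
  then show ?thesis using core_subset_Omega
    by (auto simp: sets_restrict_space_iff sets_mu_tilde_alpha[OF Omega_sets])
qed

lemma space_restrict_core: "space (restrict_space \<mu> core) = core"
  using core_subset_Omega by (auto simp: space_restrict_space space_mu_tilde_alpha)

lemma emeasure_restrict_core:
  assumes "S \<in> sets borel" "S \<subseteq> core"
  shows "emeasure (restrict_space \<mu> core) S = ennreal (1 / (3 * ln gold_G)) * emeasure moebius_measure S"
proof -
  have "core \<inter> space \<mu> \<in> sets \<mu>" using core_subset_Omega Omega_sets core_sets
    by (auto simp: sets_mu_tilde_alpha space_mu_tilde_alpha Int_absorb2)
  then have "emeasure (restrict_space \<mu> core) S = emeasure \<mu> S"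
    using assms by (intro emeasure_restrict_space) auto
  then show ?thesis using assms core_subset_Omega Omega_sets by (simp add: emeasure_mu_tilde_alpha)
qed

lemma Phi_vimage:
  assumes "B \<subseteq> core"
  shows "\<Phi> ` (\<Phi> -` B \<inter> core) = B"
proof -
  have "B \<subseteq> \<Phi> ` core" using assms bij_Phi by (simp add: bij_betw_def)
  then show ?thesis by auto
qed

lemma automorphism_Phi: "automorphism_on \<mu> \<Phi> core"
  unfolding automorphism_on_def
proof (intro conjI)
  let ?R = "restrict_space \<mu> core"
  show "core \<in> sets \<mu>" using core_subset_Omega core_sets by (simp add: sets_mu_tilde_alpha[OF Omega_sets])
  show "space \<mu> - core \<in> null_sets \<mu>" using null_Omega_minus_core by (simp add: space_mu_tilde_alpha)
  show "bij_betw \<Phi> core core" by (rule bij_Phi)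
  have vim: "\<Phi> -` B \<inter> core \<in> sets borel" if "B \<in> sets borel" for B
  proof -
    have "\<Phi> -` B \<inter> space borel \<in> sets borel" using that by (rule measurable_sets[OF Phi_alpha_measurable])
    then have "(\<Phi> -` B \<inter> space borel) \<inter> core \<in> sets borel" using core_sets by (rule sets.Int)
    then show ?thesis by simp
  qed
  show meas: "\<Phi> \<in> measurable ?R ?R"
  proof (rule measurableI)
    show "\<Phi> x \<in> space ?R" if "x \<in> space ?R" for x using that Phi_core(1) by (simp add: space_restrict_core)
    show "\<Phi> -` B \<inter> space ?R \<in> sets ?R" if "B \<in> sets ?R" for B
      using that by (auto simp: space_restrict_core sets_restrict_core intro: vim)
  qed
  show "the_inv_into core \<Phi> \<in> measurable ?R ?R"
  proof (rule measurableI)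
    show "the_inv_into core \<Phi> x \<in> space ?R" if "x \<in> space ?R" for x
      using that bij_betw_the_inv_into[OF bij_Phi] by (auto simp: space_restrict_core bij_betw_def)
    show "the_inv_into core \<Phi> -` B \<inter> space ?R \<in> sets ?R" if B: "B \<in> sets ?R" for B
    proof -
      have Bd: "B \<in> sets borel" "B \<subseteq> core" using B by (auto simp: sets_restrict_core)
      have inj: "inj_on \<Phi> core" and im: "\<Phi> ` core = core" using bij_Phi by (auto simp: bij_betw_def)
      \<comment> \<open>A preimage under the inverse is a forward image, so its measurability is
        \<open>Phi_image_sets\<close>.\<close>
      have "the_inv_into core \<Phi> -` B \<inter> core = \<Phi> ` B"
      proof (intro equalityI subsetI)
        fix z assume z: "z \<in> the_inv_into core \<Phi> -` B \<inter> core"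
        then have "\<Phi> (the_inv_into core \<Phi> z) = z" using im by (intro f_the_inv_into_f[OF inj]) auto
        then show "z \<in> \<Phi> ` B" using z by (metis IntD1 imageI vimageE)
      next
        fix z assume "z \<in> \<Phi> ` B"
        then obtain v where "v \<in> B" "z = \<Phi> v" by auto
        then show "z \<in> the_inv_into core \<Phi> -` B \<inter> core"
          using the_inv_into_f_f[OF inj, of v] Bd im by auto
      qed
      then show ?thesis
        using Phi_image_sets[OF Bd] Bd im by (auto simp: space_restrict_core sets_restrict_core)
    qed
  qed
  show "distr ?R ?R \<Phi> = ?R"
  proof (rule measure_eqI)
    fix B assume "B \<in> sets (distr ?R ?R \<Phi>)"
    then have B: "B \<in> sets ?R" by simp
    then have Bd: "B \<in> sets borel" "B \<subseteq> core" by (auto simp: sets_restrict_core)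
    let ?E = "\<Phi> -` B \<inter> core"
    have E: "?E \<in> sets borel" "?E \<subseteq> core" using vim[OF Bd(1)] by auto
    have "emeasure (distr ?R ?R \<Phi>) B = emeasure ?R ?E"
      using emeasure_distr[OF meas B] by (simp add: space_restrict_core)
    also have "\<dots> = ennreal (1 / (3 * ln gold_G)) * emeasure moebius_measure (\<Phi> ` ?E)"
      by (simp only: emeasure_restrict_core[OF E] Phi_image_measure[OF E])
    also have "\<dots> = emeasure ?R B"
      by (simp only: Phi_vimage[OF Bd(2)] emeasure_restrict_core[OF Bd])
    finally show "emeasure (distr ?R ?R \<Phi>) B = emeasure ?R B" .
  qed simp
qed

lemma sets_nu: "sets \<nu> = sets (restrict_space borel (I_alpha \<alpha>))"
  by (simp add: nu_alpha_def)

lemma fst_measurable_nu: "fst \<in> measurable \<mu> \<nu>"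
proof -
  have "fst \<in> measurable \<mu> borel"
    unfolding mu_tilde_alpha_def mu_alpha_def by (simp add: measurable_restrict_space1 cong: measurable_cong_sets)
  then have "fst \<in> measurable \<mu> (restrict_space borel (I_alpha \<alpha>))"
    using Omega_fst by (intro measurable_restrict_space2) (auto simp: space_mu_tilde_alpha)
  then show ?thesis by (simp add: nu_alpha_def)
qed

lemma extension_Phi: "is_extension \<mu> \<Phi> \<nu> \<phi> fst"
  unfolding is_extension_def
proof (intro conjI ballI)
  show "fst \<in> measurable \<mu> \<nu>" by (rule fst_measurable_nu)
  \<comment> \<open>The identity holds everywhere: at x = 0 both maps return 0 by
    convention.\<close>
  show "AE z in \<mu>. fst (\<Phi> z) = \<phi> (fst z)"
    by (auto simp: Phi_alpha_def phi_alpha_def)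
  fix E assume E: "E \<in> sets \<nu>"
  have "fst \<in> measurable \<mu> (restrict_space borel (I_alpha \<alpha>))"
    using fst_measurable_nu sets_nu by (simp cong: measurable_cong_sets)
  then show "emeasure \<nu> E = emeasure \<mu> (fst -` E \<inter> space \<mu>)"
    using E sets_nu unfolding nu_alpha_def by (intro emeasure_distr) auto
qed

end

section \<open>Minimality\<close>

context odd_alpha
begin

text \<open>A single step can expand fibres (the derivative is \<open>y\<^sup>2\<close> at the image height \<open>y\<close>, and \<open>y\<close> may
  exceed 1). The weights are chosen so that every step contracts after reweighting.\<close>

definition wt :: "real \<Rightarrow> real" where
  "wt y = (if y < 2 - G then 1 else if y < 1 then 3 / 2 else 9 / 5)"

lemma wt_ge_1: "1 \<le> wt y"
  by (simp add: wt_def)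

lemma snd_Phi:
  assumes "z \<in> core"
  defines "m \<equiv> signed_digit \<alpha> (fst z)"
  shows "snd (\<Phi> z) = 1 / (of_int \<bar>m\<bar> + of_int (sgn m) * snd z)" "0 < of_int \<bar>m\<bar> + of_int (sgn m) * snd z"
proof -
  obtain x y where z: "z = (x, y)" by (cases z)
  have d: "(x, y) \<in> core" using assms z by simp
  have x: "x \<noteq> 0" "1 \<le> dg x" "0 < y" using d dg_pos core_nonzero by (auto simp: core_def)
  then have m: "m = (if x < 0 then - dg x else dg x)" by (simp add: m_def z signed_digit_def)
  have e: "of_int \<bar>m\<bar> + of_int (sgn m) * snd z = of_int (dg x) + sgn x * y"
    using x by (auto simp: m z)
  show "snd (\<Phi> z) = 1 / (of_int \<bar>m\<bar> + of_int (sgn m) * snd z)"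
    unfolding e using x by (simp add: z Phi_alpha_def)
  have "0 < snd (\<Phi> z)" using Phi_core(1)[OF assms(1)] by (cases "\<Phi> z") (auto simp: core_def)
  then show "0 < of_int \<bar>m\<bar> + of_int (sgn m) * snd z"
    unfolding \<open>snd (\<Phi> z) = 1 / (of_int \<bar>m\<bar> + of_int (sgn m) * snd z)\<close> by simp
qed

text \<open>Heights stretch only when an image reaches the top strip, which takes digit 1 with
  negative sign and a source in the bottom strip. There 9/10 * 9/5 * (G - 1) just exceeds 1; the
  value 3/2 is chosen to make the other transitions work as well.\<close>

lemma wt_contraction:
  assumes z: "z \<in> core"
  shows "snd (\<Phi> z) * wt (snd z) \<le> 9 / 10 * wt (snd (\<Phi> z))"
proof -
  define m y d where "m = signed_digit \<alpha> (fst z)" and "y = snd z"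
    and "d = of_int \<bar>m\<bar> + of_int (sgn m) * y"
  have d: "snd (\<Phi> z) = 1 / d" "0 < d" using snd_Phi[OF z] by (auto simp: d_def m_def y_def)
  have y: "0 < y" "y < G" using z by (cases z; auto simp: y_def core_def)+
  have "1 / d < G" using Phi_core(1)[OF z] d by (cases "\<Phi> z") (auto simp: core_def)
  then have "1 < G * d" using d(2) by (simp add: field_simps)
  then have "(G - 1) * 1 < (G - 1) * (G * d)"
    using gold_G_bounds by (intro mult_strict_left_mono) auto
  also have "(G - 1) * (G * d) = (G * G - G) * d" by (simp add: algebra_simps)
  also have "\<dots> = d" by (simp add: gold_G_square)
  finally have dG: "G - 1 < d" by simp
  have mo: "odd m" using Phi_core(2)[OF z] by (simp add: m_def)
  \<comment> \<open>The alternatives are a positive sign, digit 1 with negative sign, and digit at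
    least 3 with negative sign.\<close>
  have "1 + y \<le> d \<or> d = 1 - y \<or> 3 - y \<le> d"
  proof (cases "0 < m")
    case True
    then have "1 \<le> real_of_int m" by simp
    then show ?thesis using True by (simp add: d_def)
  next
    case False
    then have "m = -1 \<or> m \<le> -3" using mo by presburger
    then show ?thesis
    proof
      assume "m \<le> -3"
      then have "real_of_int m \<le> -3" by simp
      then show ?thesis using \<open>m \<le> -3\<close> by (simp add: d_def)
    qed (simp add: d_def)
  qed
  then consider (far) "1 + y \<le> d \<or> 3 - y \<le> d" | (near) "d = 1 - y" by blast
  then have "wt y \<le> 9 / 10 * wt (1 / d) * d"
  proof cases
    case far
    have d1: "1 < d" using far y gold_G_bounds by linarith
    show ?thesis
    proof (cases "1 / d < 2 - G")
      case True
      then have "1 < d * (2 - G)" using d(2) by (simp add: field_simps)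
      also have "\<dots> \<le> d * (382 / 1000)" using d(2) gold_G_bounds by (intro mult_left_mono) auto
      finally show ?thesis using True by (auto simp: wt_def)
    next
      case False
      then have w: "wt (1 / d) = 3 / 2" using d1 by (simp add: wt_def)
      \<comment> \<open>The constant is a lower bound for 3 - G, which bounds both 1 + y for y \<ge>
        2 - G and 3 - y for y < G from below.\<close>
      have "2 - G \<le> y \<Longrightarrow> 1381 / 1000 < d" "1 \<le> y \<Longrightarrow> 1381 / 1000 < d" using far y gold_G_bounds by linarith+
      then show ?thesis unfolding w using d1 by (auto simp: wt_def)
    qed
  next
    case near
    have "y < 2 - G" using dG near by simp
    then have w: "wt y = 1" by (simp add: wt_def)
    have "1 < 1 / d" using near y d(2) by simp
    then have "\<not> 1 / d < 2 - G" "\<not> 1 / d < 1" using gold_G_bounds by linarith+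
    then have w': "wt (1 / d) = 9 / 5" by (simp only: wt_def if_False)
    have "618 / 1000 < d" using dG gold_G_bounds by simp
    then show ?thesis unfolding w w' by simp
  qed
  then show ?thesis using d(2) by (simp add: d(1) y_def[symmetric] field_simps)
qed

text \<open>\<open>cylinder ms\<close> prescribes the past: the head of \<open>ms\<close> is the most recent digit.\<close>

primrec cylinder :: "int list \<Rightarrow> (real \<times> real) set" where
  "cylinder [] = core"
| "cylinder (m # ms) = \<Phi> ` {z \<in> cylinder ms. signed_digit \<alpha> (fst z) = m}"

lemma cylinder_subset_core: "cylinder ms \<subseteq> core"
  by (induction ms) (use Phi_core(1) in auto)

lemma cylinder_cover:
  assumes "z \<in> core"
  shows "\<exists>ms. length ms = n \<and> z \<in> cylinder ms"
  using assms
proof (induction n arbitrary: z)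
  case (Suc n)
  obtain v where v: "v \<in> core" "z = \<Phi> v" using Suc.prems bij_Phi unfolding bij_betw_def by blast
  obtain ms where "length ms = n" "v \<in> cylinder ms" using Suc.IH v(1) by blast
  then show ?case using v(2) by (intro exI[of _ "signed_digit \<alpha> (fst v) # ms"]) auto
qed auto

lemma snd_Phi_diff:
  assumes "u \<in> core" "v \<in> core" "signed_digit \<alpha> (fst u) = signed_digit \<alpha> (fst v)"
  shows "\<bar>snd (\<Phi> u) - snd (\<Phi> v)\<bar> = snd (\<Phi> u) * snd (\<Phi> v) * \<bar>snd u - snd v\<bar>"
proof -
  define m where "m = signed_digit \<alpha> (fst u)"
  define a b where "a = of_int \<bar>m\<bar> + of_int (sgn m) * snd u" and "b = of_int \<bar>m\<bar> + of_int (sgn m) * snd v"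
  have ab: "snd (\<Phi> u) = 1 / a" "snd (\<Phi> v) = 1 / b" "0 < a" "0 < b"
    using snd_Phi[OF assms(1)] snd_Phi[OF assms(2)] assms(3) by (auto simp: a_def b_def m_def)
  have "\<bar>real_of_int (sgn m)\<bar> = 1" using Phi_core(2)[OF assms(1)] by (auto simp: m_def sgn_if)
  moreover have "b - a = of_int (sgn m) * (snd v - snd u)" by (simp add: a_def b_def algebra_simps)
  ultimately have "\<bar>b - a\<bar> = \<bar>snd u - snd v\<bar>" by (simp add: abs_mult)
  moreover have "1 / a - 1 / b = (b - a) * (1 / a * (1 / b))" using ab by (simp add: field_simps)
  ultimately show ?thesis using ab by (simp add: abs_mult)
qed

text \<open>By \<open>snd_Phi_diff\<close> a step multiplies the distance by the product of the two
  image heights. This is symmetric in the points, so each height can be absorbed by the weight of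
  its own point.\<close>

lemma cylinder_diameter:
  assumes "u \<in> cylinder ms" "v \<in> cylinder ms"
  shows "\<bar>snd u - snd v\<bar> \<le> 2 * (81 / 100) ^ length ms * (wt (snd u) * wt (snd v))"
  using assms
proof (induction ms arbitrary: u v)
  case Nil
  then have "\<bar>snd u - snd v\<bar> \<le> 2 * 1" using gold_G_bounds by (auto simp: core_def)
  also have "\<dots> \<le> 2 * (wt (snd u) * wt (snd v))"
    using mult_mono[OF wt_ge_1[of "snd u"] wt_ge_1[of "snd v"]] wt_ge_1[of "snd u"] by simp
  finally show ?case by simp
next
  case (Cons m ms)
  obtain a b where ab: "u = \<Phi> a" "v = \<Phi> b" "a \<in> cylinder ms" "b \<in> cylinder ms"
    "signed_digit \<alpha> (fst a) = m" "signed_digit \<alpha> (fst b) = m"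
    using Cons.prems by auto
  have core: "a \<in> core" "b \<in> core" using ab cylinder_subset_core by auto
  have pos: "0 < snd u" "0 < snd v" using Phi_core(1) core ab(1,2) by (auto simp: core_def split_beta)
  have pw: "0 \<le> wt y" for y using wt_ge_1[of y] by simp
  define q where "q = 2 * (81 / 100 :: real) ^ length ms"
  have q: "0 \<le> q" by (simp add: q_def)
  have "\<bar>snd u - snd v\<bar> = snd u * snd v * \<bar>snd a - snd b\<bar>"
    unfolding ab(1,2) using core ab by (intro snd_Phi_diff) auto
  also have "\<dots> \<le> snd u * snd v * (q * (wt (snd a) * wt (snd b)))"
    using Cons.IH[OF ab(3,4)] pos by (intro mult_left_mono) (auto simp: q_def)
  also have "\<dots> = q * ((snd u * wt (snd a)) * (snd v * wt (snd b)))" by simp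
  \<comment> \<open>Each point contributes a factor 9/10, whence the rate 81/100.\<close>
  also have "\<dots> \<le> q * ((9 / 10 * wt (snd u)) * (9 / 10 * wt (snd v)))"
  proof (rule mult_left_mono[OF mult_mono q])
    show "snd u * wt (snd a) \<le> 9 / 10 * wt (snd u)" "snd v * wt (snd b) \<le> 9 / 10 * wt (snd v)"
      using wt_contraction core unfolding ab(1,2) by blast+
  qed (use pos pw in auto)
  also have "\<dots> = 2 * (81 / 100) ^ length (m # ms) * (wt (snd u) * wt (snd v))" by (simp add: q_def)
  finally show ?case .
qed

lemma cylinder_inside_open:
  assumes "z \<in> core" "open U" "snd z \<in> U"
  shows "\<exists>ms. z \<in> cylinder ms \<and> snd ` cylinder ms \<subseteq> U"
proof -
  obtain e where e: "0 < e" "\<And>y. dist y (snd z) < e \<Longrightarrow> y \<in> U"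
    using assms(2,3) by (auto simp: open_dist)
  \<comment> \<open>The diameter bound carries the constant 2 and two weights of at most 2 each,
    hence the 8.\<close>
  obtain n where n: "(81 / 100 :: real) ^ n < e / 8"
    using real_arch_pow_inv[of "e / 8" "81 / 100"] e(1) by auto
  obtain ms where ms: "length ms = n" "z \<in> cylinder ms" using cylinder_cover[OF assms(1)] by blast
  have "snd v \<in> U" if v: "v \<in> cylinder ms" for v
  proof -
    have w: "wt y \<le> 2" "0 \<le> wt y" for y by (simp_all add: wt_def)
    have "\<bar>snd v - snd z\<bar> \<le> 2 * (81 / 100) ^ n * (wt (snd v) * wt (snd z))"
      using cylinder_diameter[OF v ms(2)] ms(1) by simp
    also have "\<dots> \<le> 2 * (81 / 100) ^ n * (2 * 2)"
      using w by (intro mult_left_mono mult_mono) auto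
    also have "\<dots> < e" using n by simp
    finally show ?thesis using e(2) by (simp add: dist_real_def)
  qed
  then show ?thesis using ms(2) by blast
qed

section \<open>The sigma-algebra generated by the past\<close>

definition past_sets :: "(real \<times> real) set set" where
  "past_sets = {(\<Phi> ^^ n) ` (fst -` E \<inter> core) |n E. E \<in> sets \<nu>}"

lemma funpow_Phi_image:
  assumes "X \<in> sets borel" "X \<subseteq> core"
  shows "(\<Phi> ^^ n) ` X \<in> sets borel \<and> (\<Phi> ^^ n) ` X \<subseteq> core"
proof (induction n)
  case (Suc n)
  have "(\<Phi> ^^ Suc n) ` X = \<Phi> ` (\<Phi> ^^ n) ` X" by (simp only: funpow.simps(2) image_comp)
  moreover have "\<Phi> ` (\<Phi> ^^ n) ` X \<subseteq> \<Phi> ` core" using Suc by (intro image_mono) simp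
  ultimately show ?case using Suc Phi_image_sets bij_Phi by (simp add: bij_betw_def)
qed (use assms in simp)

lemma fst_vimage_core_sets: "E \<in> sets \<nu> \<Longrightarrow> fst -` E \<inter> core \<in> sets borel"
proof -
  assume "E \<in> sets \<nu>"
  then have "E \<in> sets borel" unfolding sets_nu I_alpha_def by (auto simp: sets_restrict_space_iff)
  then have "fst -` E \<inter> space borel \<in> sets (borel :: (real \<times> real) measure)"
    by (rule measurable_sets[OF borel_measurable_fst_prod])
  then show ?thesis using core_sets by auto
qed

lemma past_sets_borel: "X \<in> past_sets \<Longrightarrow> X \<in> sets borel \<and> X \<subseteq> core"
proof -
  assume "X \<in> past_sets"
  then obtain n E where "X = (\<Phi> ^^ n) ` (fst -` E \<inter> core)" "E \<in> sets \<nu>" by (auto simp: past_sets_def)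
  then show ?thesis using funpow_Phi_image[of "fst -` E \<inter> core" n] fst_vimage_core_sets by simp
qed

lemma past_sets_Pow: "past_sets \<subseteq> Pow core"
  using past_sets_borel by auto

lemma sigma_past_borel:
  assumes "S \<in> sigma_sets core past_sets"
  shows "S \<in> sets borel \<and> S \<subseteq> core"
  using assms
proof induction
  case (Basic a)
  then show ?case by (rule past_sets_borel)
next
  case (Compl a)
  then show ?case using core_sets by auto
next
  case (Union a)
  then show ?case by auto
qed auto

text \<open>The generators are shifted from n to n + 1. Complements survive because \<Phi> is a
  bijection of \<open>core\<close>.\<close>

lemma sigma_past_Phi:
  assumes "S \<in> sigma_sets core past_sets"
  shows "\<Phi> ` S \<in> sigma_sets core past_sets"
  using assms
proof induction
  case (Basic a)
  then obtain n E where "a = (\<Phi> ^^ n) ` (fst -` E \<inter> core)" "E \<in> sets \<nu>" by (auto simp: past_sets_def)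
  then have "\<Phi> ` a = (\<Phi> ^^ Suc n) ` (fst -` E \<inter> core)" "E \<in> sets \<nu>" by (auto simp: image_comp)
  then have "\<Phi> ` a \<in> past_sets" unfolding past_sets_def by blast
  then show ?case by (rule sigma_sets.Basic)
next
  case Empty
  then show ?case by (simp add: sigma_sets.Empty)
next
  case (Compl a)
  have "a \<subseteq> core" using Compl.hyps sigma_past_borel by blast
  then have "\<Phi> ` (core - a) = core - \<Phi> ` a"
    using bij_Phi inj_on_image_set_diff[of \<Phi> core core a] by (auto simp: bij_betw_def)
  then show ?case using Compl.IH sigma_sets.Compl by metis
next
  case (Union a)
  then show ?case by (simp add: image_UN sigma_sets.Union)
qed

lemma fst_vimage_in_past:
  assumes "E \<in> sets borel"
  shows "fst -` E \<inter> core \<in> sigma_sets core past_sets"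
proof -
  have "E \<inter> I_alpha \<alpha> \<in> sets \<nu>" using assms unfolding sets_nu by (auto simp: sets_restrict_space)
  \<comment> \<open>Base sets are generators with n = 0; cutting down to the base interval changes
    nothing on \<open>core\<close> and makes the set measurable for \<nu>.\<close>
  moreover have "fst -` E \<inter> core = (\<Phi> ^^ 0) ` (fst -` (E \<inter> I_alpha \<alpha>) \<inter> core)"
    using core_subset_Omega Omega_fst by auto
  ultimately have "fst -` E \<inter> core \<in> past_sets" unfolding past_sets_def by blast
  then show ?thesis by (rule sigma_sets.Basic)
qed

lemma sigma_algebra_past: "sigma_algebra core (sigma_sets core past_sets)"
  by (rule sigma_algebra_sigma_sets[OF past_sets_Pow])

text \<open>A cylinder arises by alternately imposing a digit, which is a condition on the first
  coordinate alone, and applying \<Phi>.\<close>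

lemma cylinder_in_past: "cylinder ms \<in> sigma_sets core past_sets"
proof (induction ms)
  case Nil
  then show ?case by (simp add: sigma_sets_top)
next
  case (Cons m ms)
  interpret sigma_algebra core "sigma_sets core past_sets" by (rule sigma_algebra_past)
  have "signed_digit \<alpha> -` {m} \<inter> space borel \<in> sets borel"
    by (rule measurable_sets[OF signed_digit_measurable]) simp
  then have "fst -` (signed_digit \<alpha> -` {m}) \<inter> core \<in> sigma_sets core past_sets"
    by (intro fst_vimage_in_past) simp
  then have "cylinder ms \<inter> (fst -` (signed_digit \<alpha> -` {m}) \<inter> core) \<in> sigma_sets core past_sets"
    using Cons by (rule Int[rotated])
  moreover have "{z \<in> cylinder ms. signed_digit \<alpha> (fst z) = m} = cylinder ms \<inter> (fst -` (signed_digit \<alpha> -` {m}) \<inter> core)"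
    using cylinder_subset_core by auto
  ultimately show ?case by (auto intro: sigma_past_Phi)
qed

lemma borel_in_past:
  assumes "B \<in> sets borel"
  shows "B \<inter> core \<in> sigma_sets core past_sets"
proof -
  define P where "P = sigma core past_sets"
  have P: "space P = core" "sets P = sigma_sets core past_sets"
    using past_sets_Pow by (simp_all add: P_def)
  have "fst \<in> borel_measurable P"
    using fst_vimage_in_past P by (intro measurableI) auto
  moreover have "snd \<in> borel_measurable P"
  proof (rule borel_measurableI)
    fix U :: "real set" assume U: "open U"
    \<comment> \<open>Every point has a cylinder around it whose heights stay in U, and there are
      only countably many finite digit lists, so the union is countable.\<close>
    have "snd -` U \<inter> core = (\<Union>ms\<in>{ms. snd ` cylinder ms \<subseteq> U}. cylinder ms)"
      using cylinder_inside_open[OF _ U] cylinder_subset_core by blast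
    also have "\<dots> \<in> sets P"
      using cylinder_in_past P by (intro sets.countable_UN') auto
    finally show "snd -` U \<inter> space P \<in> sets P" by (simp add: P)
  qed
  ultimately have "(\<lambda>z. (fst z, snd z)) \<in> measurable P borel"
    by (rule borel_measurable_Pair)
  then have "(\<lambda>z. (fst z, snd z)) -` B \<inter> space P \<in> sets P"
    using assms by (rule measurable_sets)
  then show ?thesis by (simp add: P vimage_def Int_def)
qed

lemma minimal_Phi: "eq_mod_null \<mu> (sigma_sets core past_sets) (sets \<mu>)"
  unfolding eq_mod_null_def
proof (intro conjI ballI)
  fix A assume "A \<in> sigma_sets core past_sets"
  then have "A \<in> sets borel" "A \<subseteq> core" using sigma_past_borel by blast+
  then have "A \<in> sets \<mu>" using core_subset_Omega by (auto simp: sets_mu_tilde_alpha[OF Omega_sets])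
  then show "\<exists>B\<in>sets \<mu>. (A - B) \<union> (B - A) \<in> null_sets \<mu>" by (intro bexI[of _ A]) auto
next
  fix B assume B: "B \<in> sets \<mu>"
  then have Bb: "B \<in> sets borel" "B \<subseteq> \<Omega>" by (auto simp: sets_mu_tilde_alpha[OF Omega_sets])
  have "B - core \<in> null_sets \<mu>"
  proof (rule null_sets_subset[OF null_Omega_minus_core])
    show "B - core \<in> sets \<mu>" using Bb core_sets by (auto simp: sets_mu_tilde_alpha[OF Omega_sets])
    show "B - core \<subseteq> \<Omega> - core" using Bb by auto
  qed
  moreover have "(B \<inter> core - B) \<union> (B - B \<inter> core) = B - core" by auto
  ultimately show "\<exists>A\<in>sigma_sets core past_sets. (A - B) \<union> (B - A) \<in> null_sets \<mu>"
    using borel_in_past[OF Bb(1)] by (intro bexI[of _ "B \<inter> core"]) auto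
qed

end

theorem theorem14:
  fixes \<alpha> :: real
  assumes "\<alpha> \<in> {gold_g..gold_G}"
  shows "is_natural_extension (mu_tilde_alpha \<alpha>) (Phi_alpha \<alpha>) (nu_alpha \<alpha>) (phi_alpha \<alpha>) fst"
proof -
  interpret odd_alpha \<alpha> using assms by unfold_locales auto
  show ?thesis
    unfolding is_natural_extension_def
    using extension_Phi automorphism_Phi minimal_Phi unfolding past_sets_def by blast
qed

end
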